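(* Let $X$ be a separable infinite-dimensional Banach space such that $\eta_e(X):=\sup_{T\in\mathcal{SE}(X)}\eta_e(T)=\omega_1$. Then the set of super-ergodic operators strictly separates the sets of ergodic and uniformly ergodic operators on $X$, that is, $\mathcal{UE}(X)\subsetneq\mathcal{SE}(X)\subsetneq\mathcal E(X)$.
   Context: $L(X)$ is the space of bounded operators on $X$. For $T\in L(X)$ and $n\ge1$, the $n$-th Cesaro-mean of $T$ is $A_n=\frac1n\sum_{k=0}^{n-1}T^k$. $T$ is ergodic if $(A_n)_n$ converges in $L(X)$ for the strong operator topology, and uniformly ergodic if $(A_n)_n$ converges in operator norm. For an ultrafilter $\mathcal U$ on $\mathbb N$, let $X_{\mathcal U}=\ell^\infty(X)/\mathcal C_{\mathcal U}(X)$, where $\ell^\infty(X)$ is the Banach space of bounded sequences in $X$ and $\mathcal C_{\mathcal U}(X)$ is the subspace of sequences $(x_n)$ with $\lim_{\mathcal U}\|x_n\|=0$; the ultrapower operator is $T_{\mathcal U}\big((x_n)_n+\mathcal C_{\mathcal U}(X)\big)=(Tx_n)_n+\mathcal C_{\mathcal U}(X)$. $T$ is super-ergodic if $T_{\mathcal U}$ is ergodic on $X_{\mathcal U}$ for every ultrafilter $\mathcal U$ on $\mathbb N$. $\mathcal E(X)$, $\mathcal{SE}(X)$, $\mathcal{UE}(X)$ denote the sets of ergodic, super-ergodic and uniformly ergodic operators in $L(X)$. $\mathbb N=\{1,2,\dots\}$. $\mathbb N^{\uparrow<\mathbb N}$ is the set of finite strictly increasing sequences in $\mathbb N$, including the empty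 sequence; $|s|$ is the length of $s$ and $s_p$ its $p$-th element. $B_X$ is the closed unit ball of $X$. For $\varepsilon>0$, $\mathcal A_e(T,\varepsilon)$ is the tree on $\mathbb N$ consisting of all $s\in\mathbb N^{\uparrow<\mathbb N}$ such that $|s|\le1$, or there exists $x\in B_X$ with $\|A_{s_p}x-A_{s_{p+1}}x\|>\varepsilon$ for all $1\le p<|s|$. For $T$ super-ergodic, $\eta_e(T)=\sup_{\varepsilon>0}h(\mathcal A_e(T,\varepsilon))$, where the height $h$ of a tree $\mathcal T$ is defined as follows: put $\mathcal T^{(0)}=\mathcal T$, $\mathcal T^{(\alpha+1)}=\{s:\ s \text{ has a proper extension in }\mathcal T^{(\alpha)}\}$, $\mathcal T^{(\lambda)}=\bigcap_{\alpha<\lambda}\mathcal T^{(\alpha)}$ for limit $\lambda$; $h(\mathcal T)$ is the least $\alpha$ with $\mathcal T^{(\alpha)}=\emptyset$ if such an $\alpha$ exists, and $h(\mathcal T)=\omega_1$ otherwise. *)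

theory Defs
  imports "HOL-Analysis.Analysis" "HOL-Library.Sublist"
begin

section \<open>The ordinals up to \<open>\<omega>\<^sub>1\<close>\<close>

text \<open>
  The ordinals \<open>\<alpha> \<le> \<omega>\<^sub>1\<close> are the initial segments of the well-order of type \<open>\<omega>\<^sub>1\<close>, ordered
  by inclusion, so that \<open>top\<close> is \<open>\<omega>\<^sub>1\<close>. That the order type is \<open>\<omega>\<^sub>1 + 1\<close> is
  confirmed by the lemmas \<open>countable_lessThan_omega1\<close> and \<open>uncountable_lessThan_omega1\<close>.
\<close>

lemma wo_rel_cardSuc_natLeq: "wo_rel (cardSuc natLeq)"
  using cardSuc_Card_order[OF natLeq_Card_order] by (auto simp: wo_rel_def card_order_on_def)

typedef omega1_ordinal =
  "{S :: nat set set. ofilter (cardSuc natLeq) S}"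
  using wo_rel.Field_ofilter[OF wo_rel_cardSuc_natLeq] by blast


instantiation omega1_ordinal :: complete_linorder
begin

definition "a \<le> b \<longleftrightarrow> Rep_omega1_ordinal a \<subseteq> Rep_omega1_ordinal b"
definition "a < b \<longleftrightarrow> Rep_omega1_ordinal a \<subset> Rep_omega1_ordinal b"
definition "Sup A = Abs_omega1_ordinal (\<Union>a\<in>A. Rep_omega1_ordinal a)"
definition "Inf A = Abs_omega1_ordinal (Field (cardSuc natLeq) \<inter> (\<Inter>a\<in>A. Rep_omega1_ordinal a))"
definition "bot = Abs_omega1_ordinal {}"
definition "top = Abs_omega1_ordinal (Field (cardSuc natLeq))"
definition "sup (a::omega1_ordinal) b = (if a \<le> b then b else a)"
definition "inf (a::omega1_ordinal) b = (if a \<le> b then a else b)"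

lemma omega1_ordinal_linear: "(a::omega1_ordinal) \<le> b \<or> b \<le> a"
  using wo_rel.ofilter_linord[OF wo_rel_cardSuc_natLeq] Rep_omega1_ordinal[of a] Rep_omega1_ordinal[of b]
  by (auto simp: less_eq_omega1_ordinal_def)

lemma Rep_omega1_ordinal_Sup: "Rep_omega1_ordinal (Sup A) = (\<Union>a\<in>A. Rep_omega1_ordinal a)"
proof -
  have "ofilter (cardSuc natLeq) (\<Union>a\<in>A. Rep_omega1_ordinal a)"
    using Rep_omega1_ordinal by (intro wo_rel.ofilter_UNION[OF wo_rel_cardSuc_natLeq]) auto
  then show ?thesis by (simp add: Sup_omega1_ordinal_def Abs_omega1_ordinal_inverse)
qed

lemma Rep_omega1_ordinal_le: "Rep_omega1_ordinal a \<subseteq> Field (cardSuc natLeq)"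
  using Rep_omega1_ordinal[of a] by (auto simp: ofilter_def)

lemma Rep_omega1_ordinal_Inf: "Rep_omega1_ordinal (Inf A) =
    Field (cardSuc natLeq) \<inter> (\<Inter>a\<in>A. Rep_omega1_ordinal a)"
proof -
  have "ofilter (cardSuc natLeq) (Field (cardSuc natLeq) \<inter> (\<Inter>a\<in>A. Rep_omega1_ordinal a))"
    using Rep_omega1_ordinal by (fastforce simp: ofilter_def under_def Field_def)
  then show ?thesis by (simp add: Inf_omega1_ordinal_def Abs_omega1_ordinal_inverse)
qed

lemma Rep_omega1_ordinal_bot: "Rep_omega1_ordinal bot = {}"
  by (simp add: bot_omega1_ordinal_def Abs_omega1_ordinal_inverse ofilter_def)

lemma Rep_omega1_ordinal_top: "Rep_omega1_ordinal top = Field (cardSuc natLeq)"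
  using wo_rel.Field_ofilter[OF wo_rel_cardSuc_natLeq] by (simp add: top_omega1_ordinal_def Abs_omega1_ordinal_inverse)

instance
proof
  fix x y z :: omega1_ordinal and A :: "omega1_ordinal set"
  show "x < y \<longleftrightarrow> x \<le> y \<and> \<not> y \<le> x"
    by (auto simp: less_omega1_ordinal_def less_eq_omega1_ordinal_def)
  show "x \<le> x" by (simp add: less_eq_omega1_ordinal_def)
  show "x \<le> y \<Longrightarrow> y \<le> z \<Longrightarrow> x \<le> z" by (auto simp: less_eq_omega1_ordinal_def)
  show antisym: "x \<le> y \<Longrightarrow> y \<le> x \<Longrightarrow> x = y"
    by (simp add: less_eq_omega1_ordinal_def flip: Rep_omega1_ordinal_inject)
  show "x \<le> y \<or> y \<le> x" by (rule omega1_ordinal_linear)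
  show "inf x y \<le> x" "inf x y \<le> y" "x \<le> sup x y" "y \<le> sup x y"
    "x \<le> y \<Longrightarrow> x \<le> z \<Longrightarrow> x \<le> inf y z" "y \<le> x \<Longrightarrow> z \<le> x \<Longrightarrow> sup y z \<le> x"
    using omega1_ordinal_linear[of x y] 
    by (auto simp: inf_omega1_ordinal_def sup_omega1_ordinal_def less_eq_omega1_ordinal_def)
  show "x \<in> A \<Longrightarrow> Inf A \<le> x" "x \<in> A \<Longrightarrow> x \<le> Sup A"
    by (auto simp: less_eq_omega1_ordinal_def Rep_omega1_ordinal_Sup Rep_omega1_ordinal_Inf)
  show "(\<And>x. x \<in> A \<Longrightarrow> z \<le> x) \<Longrightarrow> z \<le> Inf A"
    using Rep_omega1_ordinal_le by (auto simp: less_eq_omega1_ordinal_def Rep_omega1_ordinal_Inf)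
  show "(\<And>x. x \<in> A \<Longrightarrow> x \<le> z) \<Longrightarrow> Sup A \<le> z"
    by (auto simp: less_eq_omega1_ordinal_def Rep_omega1_ordinal_Sup)
  show "Inf {} = (top::omega1_ordinal)"
    by (simp add: Rep_omega1_ordinal_Inf Rep_omega1_ordinal_top flip: Rep_omega1_ordinal_inject)
  show "Sup {} = (bot::omega1_ordinal)"
    by (simp add: Rep_omega1_ordinal_Sup Rep_omega1_ordinal_bot flip: Rep_omega1_ordinal_inject)
qed

end

instance omega1_ordinal :: wellorder
proof
  fix P :: "omega1_ordinal \<Rightarrow> bool" and a :: omega1_ordinal
  assume step: "\<And>x. (\<And>y. y < x \<Longrightarrow> P y) \<Longrightarrow> P x"
  let ?I = "inv_image (ofilterIncl (cardSuc natLeq)) Rep_omega1_ordinal"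
  have "Well_order (cardSuc natLeq)" using wo_rel_cardSuc_natLeq by (simp add: wo_rel_def)
  then have wf: "wf ?I" by (intro wf_inv_image wf_ofilterIncl)
  have less_top: "P x" if "x < top" for x
    using wf that
  proof (induction x rule: wf_induct_rule)
    case (less x)
    show ?case
    proof (rule step)
      fix y assume "y < x"
      with less.prems have "(y, x) \<in> ?I" "y < top"
        using Rep_omega1_ordinal[of x] Rep_omega1_ordinal[of y] Rep_omega1_ordinal_le[of x] Rep_omega1_ordinal_le[of y]
        by (auto simp: ofilterIncl_def less_omega1_ordinal_def Rep_omega1_ordinal_top)
      then show "P y" by (rule less.IH)
    qed
  qed
  show "P a"
  proof (rule step)
    fix y assume "y < a"
    then have "y < top" by (rule order_less_le_trans) simp
    then show "P y" by (rule less_top)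
  qed
qed

lemma bij_betw_underS_omega1:
  "bij_betw (\<lambda>a. Abs_omega1_ordinal (underS (cardSuc natLeq) a)) (Field (cardSuc natLeq)) {..<top}"
  (is "bij_betw ?f ?F _")
proof -
  let ?r = "cardSuc natLeq"
  have of': "ofilter ?r (underS ?r a)" for a by (rule wo_rel.underS_ofilter[OF wo_rel_cardSuc_natLeq])
  have Rep: "Rep_omega1_ordinal (?f a) = underS ?r a" for a
    by (simp add: Abs_omega1_ordinal_inverse of')
  have "inj_on ?f ?F"
  proof (rule inj_onI)
    fix a b assume ab: "a \<in> ?F" "b \<in> ?F" "?f a = ?f b"
    then have "underS ?r a = underS ?r b" using Rep by metis
    then have "a \<notin> underS ?r b" "b \<notin> underS ?r a" by (auto simp: underS_def)
    with ab wo_rel.TOTALS[OF wo_rel_cardSuc_natLeq] show "a = b" by (auto simp: underS_def)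
  qed
  moreover have "?f a < top" if "a \<in> ?F" for a
    unfolding less_omega1_ordinal_def Rep Rep_omega1_ordinal_top using that Rep_omega1_ordinal_le[of "?f a"] Rep[of a]
    by (auto simp: underS_def)
  moreover have "x \<in> ?f ` ?F" if "x < top" for x
  proof -
    from that have "Rep_omega1_ordinal x \<noteq> ?F" by (auto simp: less_omega1_ordinal_def Rep_omega1_ordinal_top)
    with Rep_omega1_ordinal[of x] obtain a where "a \<in> ?F" "Rep_omega1_ordinal x = underS ?r a"
      using wo_rel.ofilter_underS_Field[OF wo_rel_cardSuc_natLeq] by auto
    then show ?thesis by (metis Rep_omega1_ordinal_inverse image_eqI)
  qed
  ultimately show ?thesis by (auto simp: bij_betw_def)
qed


context includes cardinal_syntax
begin

lemma countable_card_le_natLeq: "countable A \<longleftrightarrow> |A| \<le>o natLeq"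
proof -
  have "countable A \<longleftrightarrow> |A| \<le>o |UNIV :: nat set|"
    by (simp add: countable_def flip: card_of_ordLeq)
  then show ?thesis
    using card_of_nat ordIso_symmetric ordLeq_ordIso_trans by blast
qed

lemma countable_lessThan_omega1: "a < top \<Longrightarrow> countable {..<a :: omega1_ordinal}"
proof -
  let ?r = "cardSuc natLeq"
  let ?f = "\<lambda>a. Abs_omega1_ordinal (underS ?r a)"
  have card: "Card_order ?r" by (rule cardSuc_Card_order[OF natLeq_Card_order])
  assume "a < top"
  then obtain c where c: "c \<in> Field ?r" "a = ?f c"
    using bij_betw_underS_omega1 by (auto simp: bij_betw_def)
  then have Rep: "Rep_omega1_ordinal a = underS ?r c"
    by (simp add: Abs_omega1_ordinal_inverse wo_rel.underS_ofilter[OF wo_rel_cardSuc_natLeq])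
  have "|underS ?r c| <o ?r"
    using card c(1) by (rule card_of_underS)
  then have "|underS ?r c| \<le>o natLeq"
    using cardSuc_ordLeq_ordLess[OF natLeq_Card_order card_of_Card_order] by blast
  then have "countable (underS ?r c)"
    by (simp add: countable_card_le_natLeq)
  moreover have "{..<a} \<subseteq> ?f ` underS ?r c"
  proof
    fix b assume b: "b \<in> {..<a}"
    with \<open>a < top\<close> have "b < top" by auto
    then obtain d where d: "d \<in> Field ?r" "b = ?f d"
      using bij_betw_underS_omega1 by (auto simp: bij_betw_def)
    then have "Rep_omega1_ordinal b = underS ?r d"
      by (simp add: Abs_omega1_ordinal_inverse wo_rel.underS_ofilter[OF wo_rel_cardSuc_natLeq])
    with b Rep have "underS ?r d \<subset> underS ?r c"
      by (simp add: less_omega1_ordinal_def)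
    then have "d \<in> underS ?r c"
      using wo_rel.TOTALS[OF wo_rel_cardSuc_natLeq] c(1) d(1) wo_rel.TRANS[OF wo_rel_cardSuc_natLeq] wo_rel.ANTISYM[OF wo_rel_cardSuc_natLeq]
      unfolding underS_def by (smt (verit, best) antisymD mem_Collect_eq psubsetE subset_iff transD)
    with d show "b \<in> ?f ` underS ?r c" by blast
  qed
  ultimately show ?thesis by (meson countable_image countable_subset)
qed

lemma uncountable_lessThan_omega1: "uncountable {..<top :: omega1_ordinal}"
proof
  let ?r = "cardSuc natLeq"
  assume "countable {..<top :: omega1_ordinal}"
  then have "countable (Field ?r)"
    using bij_betw_underS_omega1 countable_image_inj_eq unfolding bij_betw_def by fastforce
  then have "|Field ?r| \<le>o natLeq" by (simp add: countable_card_le_natLeq)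
  moreover have "|Field ?r| =o ?r"
    by (simp add: card_of_Field_ordIso cardSuc_Card_order natLeq_Card_order)
  moreover have "natLeq <o ?r" by (simp add: cardSuc_greater natLeq_Card_order)
  ultimately show False
    using not_ordLess_ordLeq ordIso_ordLeq_trans ordIso_symmetric by blast
qed


end

abbreviation omega1 :: omega1_ordinal
  where "omega1 \<equiv> top"

definition ord_suc :: "omega1_ordinal \<Rightarrow> omega1_ordinal"
  where "ord_suc \<alpha> = (LEAST \<beta>. \<alpha> < \<beta>)"

lemma less_ord_suc: "\<alpha> < top \<Longrightarrow> \<alpha> < ord_suc \<alpha>"
  unfolding ord_suc_def by (rule LeastI)

lemma ord_suc_inject: "\<alpha> < top \<Longrightarrow> \<beta> < top \<Longrightarrow> ord_suc \<alpha> = ord_suc \<beta> \<longleftrightarrow> \<alpha> = \<beta>"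
  unfolding ord_suc_def by (metis (mono_tags, lifting) LeastI linorder_less_linear not_less_Least)

lemma the_ord_pred:
  assumes "\<alpha> < top"
  shows "(THE \<beta>. \<beta> < ord_suc \<alpha> \<and> ord_suc \<beta> = ord_suc \<alpha>) = \<alpha>"
proof (rule the_equality)
  show "\<alpha> < ord_suc \<alpha> \<and> ord_suc \<alpha> = ord_suc \<alpha>" using assms by (simp add: less_ord_suc)
next
  fix \<beta> assume \<beta>: "\<beta> < ord_suc \<alpha> \<and> ord_suc \<beta> = ord_suc \<alpha>"
  then have "\<beta> < top" by (meson order_less_le_trans top_greatest)
  with \<beta> assms show "\<beta> = \<alpha>" by (simp add: ord_suc_inject)
qed


section \<open>Trees and their height\<close>

definition derived_tree :: "'a list set \<Rightarrow> 'a list set"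
  where "derived_tree \<T> = {s. \<exists>t\<in>\<T>. strict_prefix s t}"

function tree_deriv :: "'a list set \<Rightarrow> omega1_ordinal \<Rightarrow> 'a list set" where
  "tree_deriv \<T> \<alpha> =
    (if \<alpha> = bot then \<T>
     else if \<exists>\<beta><\<alpha>. ord_suc \<beta> = \<alpha>
       then derived_tree (tree_deriv \<T> (THE \<beta>. \<beta> < \<alpha> \<and> ord_suc \<beta> = \<alpha>))
     else (\<Inter>\<beta>\<in>{..<\<alpha>}. tree_deriv \<T> \<beta>))"
  by pat_completeness auto
termination
proof (relation "inv_image {(\<alpha>, \<beta>). \<alpha> < \<beta>} snd", goal_cases)
  case 1
  show ?case by (intro wf_inv_image wf)
next
  case (2 \<T> \<alpha>)
  then obtain \<beta> where \<beta>: "\<beta> < \<alpha>" "ord_suc \<beta> = \<alpha>" by blast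
  from \<beta>(1) have "\<beta> < top" by (rule order_less_le_trans) simp
  from the_ord_pred[OF this] \<beta> show ?case by simp
next
  case (3 \<T> \<alpha> \<beta>)
  then show ?case by simp
qed

declare tree_deriv.simps [simp del]

lemma tree_deriv_zero: "tree_deriv \<T> bot = \<T>"
  by (subst tree_deriv.simps) simp

lemma tree_deriv_suc:
  assumes "\<alpha> < top"
  shows "tree_deriv \<T> (ord_suc \<alpha>) = derived_tree (tree_deriv \<T> \<alpha>)"
proof -
  have "ord_suc \<alpha> \<noteq> bot" "\<exists>\<beta><ord_suc \<alpha>. ord_suc \<beta> = ord_suc \<alpha>"
    using less_ord_suc[OF assms] not_less_bot by (metis, blast)
  then show ?thesis
    by (subst tree_deriv.simps) (simp add: the_ord_pred[OF assms])
qed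

lemma tree_deriv_limit:
  assumes "\<alpha> \<noteq> bot" "\<And>\<beta>. \<beta> < \<alpha> \<Longrightarrow> ord_suc \<beta> \<noteq> \<alpha>"
  shows "tree_deriv \<T> \<alpha> = (\<Inter>\<beta>\<in>{..<\<alpha>}. tree_deriv \<T> \<beta>)"
  using assms by (subst tree_deriv.simps) auto

text \<open>
  The search for \<open>\<alpha>\<close> is restricted to \<open>\<alpha> \<le> \<omega>\<^sub>1\<close>. This loses nothing for trees on a countable
  set, whose derivatives become stationary at a countable stage. \<open>ord_suc omega1\<close> is never used.
\<close>

definition tree_height :: "'a list set \<Rightarrow> omega1_ordinal"
  where "tree_height \<T> =
    (if \<exists>\<alpha>. tree_deriv \<T> \<alpha> = {} then LEAST \<alpha>. tree_deriv \<T> \<alpha> = {} else omega1)"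


section \<open>Ergodic and uniformly ergodic operators\<close>

text \<open>
  By Mazur's theorem every \<^class>\<open>real_normed_field\<close> is \<open>\<real>\<close> or \<open>\<complex>\<close>, so the Banach spaces with
  scalar multiplication \<open>scal\<close> as below are exactly the real and the complex ones.
\<close>

locale normed_scalars = vector_space scal
  for scal :: "'k::real_normed_field \<Rightarrow> 'a::real_normed_vector \<Rightarrow> 'a" +
  assumes scale_of_real: "scal (of_real r) x = r *\<^sub>R x"
    and norm_scale: "norm (scal c x) = norm c * norm x"

definition bounded_ops :: "('k \<Rightarrow> 'a \<Rightarrow> 'a) \<Rightarrow> ('a::real_normed_vector \<Rightarrow>\<^sub>L 'a) set"
  where "bounded_ops scal =
    {T. \<forall>c x. blinfun_apply T (scal c x) = scal c (blinfun_apply T x)}"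

text \<open>Meaningful for \<open>n \<ge> 1\<close> only.\<close>

definition cesaro :: "('a::real_normed_vector \<Rightarrow>\<^sub>L 'a) \<Rightarrow> nat \<Rightarrow> ('a \<Rightarrow>\<^sub>L 'a)"
  where "cesaro T n = (1 / real n) *\<^sub>R (\<Sum>k<n. (blinfun_compose T ^^ k) id_blinfun)"

definition ergodic_ops :: "('k \<Rightarrow> 'a \<Rightarrow> 'a) \<Rightarrow> ('a::real_normed_vector \<Rightarrow>\<^sub>L 'a) set"
  where "ergodic_ops scal = {T \<in> bounded_ops scal.
    \<exists>P\<in>bounded_ops scal. limitin strong_operator_topology (cesaro T) P sequentially}"

definition uniformly_ergodic_ops :: "('k \<Rightarrow> 'a \<Rightarrow> 'a) \<Rightarrow> ('a::real_normed_vector \<Rightarrow>\<^sub>L 'a) set"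
  where "uniformly_ergodic_ops scal = {T \<in> bounded_ops scal.
    \<exists>P\<in>bounded_ops scal. cesaro T \<longlonglongrightarrow> P}"


section \<open>Operators on a quotient space\<close>

text \<open>
  The quotient of \<open>'v\<close> by a subspace \<open>C\<close>, with the cosets as points. Operations are lifted to
  cosets by taking the union of the cosets of all results, which is a single coset when the
  operation respects \<open>C\<close> (lemmas \<open>coset_map_coset\<close> and \<open>coset_map2_coset\<close>).
\<close>

definition coset :: "'v::real_normed_vector set \<Rightarrow> 'v \<Rightarrow> 'v set"
  where "coset C x = {y. y - x \<in> C}"

definition quotient_space :: "'v::real_normed_vector set \<Rightarrow> 'v set set"
  where "quotient_space C = range (coset C)"

definition quotient_norm :: "'v::real_normed_vector set \<Rightarrow> real"
  where "quotient_norm A = (INF x\<in>A. norm x)"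

definition coset_map ::
    "'v::real_normed_vector set \<Rightarrow> ('v \<Rightarrow> 'v) \<Rightarrow> 'v set \<Rightarrow> 'v set"
  where "coset_map C f A = (\<Union>x\<in>A. coset C (f x))"

definition coset_map2 ::
    "'v::real_normed_vector set \<Rightarrow> ('v \<Rightarrow> 'v \<Rightarrow> 'v) \<Rightarrow> 'v set \<Rightarrow> 'v set \<Rightarrow> 'v set"
  where "coset_map2 C f A B = (\<Union>x\<in>A. \<Union>y\<in>B. coset C (f x y))"

lemma coset_eq_iff:
  assumes "subspace C"
  shows "coset C x = coset C y \<longleftrightarrow> x - y \<in> C"
proof
  assume "coset C x = coset C y"
  moreover have "x \<in> coset C x" using assms by (simp add: coset_def subspace_0)
  ultimately show "x - y \<in> C" by (simp add: coset_def)
next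
  assume xy: "x - y \<in> C"
  have "z - x \<in> C \<longleftrightarrow> z - y \<in> C" for z
    using subspace_add[OF assms _ xy, of "z - x"] subspace_diff[OF assms _ xy, of "z - y"] by auto
  then show "coset C x = coset C y" by (auto simp: coset_def)
qed

lemma coset_map_coset:
  assumes "subspace C" "\<And>y. y - x \<in> C \<Longrightarrow> f y - f x \<in> C"
  shows "coset_map C f (coset C x) = coset C (f x)"
proof -
  have "coset C (f y) = coset C (f x)" if "y \<in> coset C x" for y
    using that assms by (simp add: coset_eq_iff) (simp add: coset_def)
  moreover have "x \<in> coset C x" using assms(1) by (simp add: coset_def subspace_0)
  ultimately show ?thesis unfolding coset_map_def by blast
qed

lemma coset_map2_coset:
  assumes "subspace C"
    and "\<And>x' y'. x' - x \<in> C \<Longrightarrow> y' - y \<in> C \<Longrightarrow> f x' y' - f x y \<in> C"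
  shows "coset_map2 C f (coset C x) (coset C y) = coset C (f x y)"
proof -
  have "coset C (f x' y') = coset C (f x y)" if "x' \<in> coset C x" "y' \<in> coset C y" for x' y'
    using that assms by (simp add: coset_eq_iff) (simp add: coset_def)
  moreover have "x \<in> coset C x" "y \<in> coset C y"
    using assms(1) by (simp_all add: coset_def subspace_0)
  ultimately show ?thesis unfolding coset_map2_def by blast
qed

primrec quotient_orbit_sum ::
    "'v::real_normed_vector set \<Rightarrow> ('v set \<Rightarrow> 'v set) \<Rightarrow> 'v set \<Rightarrow> nat \<Rightarrow> 'v set" where
  "quotient_orbit_sum C S A 0 = coset C 0"
| "quotient_orbit_sum C S A (Suc n) =
    coset_map2 C (+) (quotient_orbit_sum C S A n) ((S ^^ n) A)"

definition quotient_cesaro ::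
    "'v::real_normed_vector set \<Rightarrow> ('v set \<Rightarrow> 'v set) \<Rightarrow> nat \<Rightarrow> 'v set \<Rightarrow> 'v set"
  where "quotient_cesaro C S n A =
    coset_map C (scaleR (1 / real n)) (quotient_orbit_sum C S A n)"

definition quotient_bounded_ops ::
    "('k \<Rightarrow> 'v \<Rightarrow> 'v) \<Rightarrow> 'v::real_normed_vector set \<Rightarrow> ('v set \<Rightarrow> 'v set) set"
  where "quotient_bounded_ops scal C =
    {P \<in> quotient_space C \<rightarrow> quotient_space C.
      (\<forall>A\<in>quotient_space C. \<forall>B\<in>quotient_space C.
        P (coset_map2 C (+) A B) = coset_map2 C (+) (P A) (P B)) \<and>
      (\<forall>c. \<forall>A\<in>quotient_space C.
        P (coset_map C (scal c) A) = coset_map C (scal c) (P A)) \<and>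
      (\<exists>K. \<forall>A\<in>quotient_space C. quotient_norm (P A) \<le> K * quotient_norm A)}"

definition quotient_ergodic_ops ::
    "('k \<Rightarrow> 'v \<Rightarrow> 'v) \<Rightarrow> 'v::real_normed_vector set \<Rightarrow> ('v set \<Rightarrow> 'v set) set"
  where "quotient_ergodic_ops scal C = {S \<in> quotient_bounded_ops scal C.
    \<exists>P\<in>quotient_bounded_ops scal C. \<forall>A\<in>quotient_space C.
      (\<lambda>n. quotient_norm (coset_map2 C (-) (quotient_cesaro C S n A) (P A)))
        \<longlonglongrightarrow> 0}"


section \<open>Ultrapowers and super-ergodic operators\<close>

text \<open>
  The space \<open>\<ell>\<^sup>\<infinity>(X)\<close> is \<^typ>\<open>nat \<Rightarrow>\<^sub>C 'a\<close>, since every sequence is continuous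
  on the discrete space \<^typ>\<open>nat\<close>.
\<close>

definition is_ultrafilter :: "'i filter \<Rightarrow> bool"
  where "is_ultrafilter \<U> \<longleftrightarrow>
    \<U> \<noteq> bot \<and> (\<forall>P. eventually P \<U> \<or> eventually (\<lambda>i. \<not> P i) \<U>)"

definition null_seqs :: "nat filter \<Rightarrow> (nat \<Rightarrow>\<^sub>C 'a::real_normed_vector) set"
  where "null_seqs \<U> = {x. ((\<lambda>n. norm (apply_bcontfun x n)) \<longlongrightarrow> 0) \<U>}"

text \<open>Meaningful only when \<open>f\<close> maps bounded sequences to bounded sequences.\<close>

definition map_seq ::
    "('a \<Rightarrow> 'a) \<Rightarrow> (nat \<Rightarrow>\<^sub>C 'a::real_normed_vector) \<Rightarrow> (nat \<Rightarrow>\<^sub>C 'a)"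
  where "map_seq f x = Bcontfun (\<lambda>n. f (apply_bcontfun x n))"

lemma apply_map_seq:
  assumes "\<And>x. norm (f x) \<le> K * norm x"
  shows "apply_bcontfun (map_seq f x) n = f (apply_bcontfun x n)"
proof -
  have "norm (f (apply_bcontfun x n)) \<le> \<bar>K\<bar> * norm x" for n
  proof -
    have "norm (f (apply_bcontfun x n)) \<le> K * norm (apply_bcontfun x n)" by (rule assms)
    also have "\<dots> \<le> \<bar>K\<bar> * norm x"
      by (intro mult_mono abs_ge_self norm_bounded abs_ge_zero norm_ge_zero)
    finally show ?thesis .
  qed
  then have "(\<lambda>n. f (apply_bcontfun x n)) \<in> bcontfun"
    by (intro bcontfun_normI) auto
  then show ?thesis by (simp add: map_seq_def Bcontfun_inverse)
qed

definition ultrapower_op ::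
    "nat filter \<Rightarrow> ('a::real_normed_vector \<Rightarrow>\<^sub>L 'a) \<Rightarrow>
      (nat \<Rightarrow>\<^sub>C 'a) set \<Rightarrow> (nat \<Rightarrow>\<^sub>C 'a) set"
  where "ultrapower_op \<U> T = coset_map (null_seqs \<U>) (map_seq (blinfun_apply T))"

lemma subspace_null_seqs: "subspace (null_seqs \<U>)"
proof -
  have *: "null_seqs \<U> = {x :: nat \<Rightarrow>\<^sub>C 'a. (apply_bcontfun x \<longlongrightarrow> 0) \<U>}"
    by (simp add: null_seqs_def tendsto_norm_zero_iff)
  show ?thesis
    unfolding * subspace_def
  proof (intro conjI ballI allI)
    show "0 \<in> {x :: nat \<Rightarrow>\<^sub>C 'a. (apply_bcontfun x \<longlongrightarrow> 0) \<U>}" by simp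
  next
    fix x y :: "nat \<Rightarrow>\<^sub>C 'a"
    assume "x \<in> {x. (apply_bcontfun x \<longlongrightarrow> 0) \<U>}" "y \<in> {x. (apply_bcontfun x \<longlongrightarrow> 0) \<U>}"
    then show "x + y \<in> {x. (apply_bcontfun x \<longlongrightarrow> 0) \<U>}"
      using tendsto_add[of "apply_bcontfun x" 0 \<U> "apply_bcontfun y" 0] by (simp add: plus_bcontfun.rep_eq)
  next
    fix x :: "nat \<Rightarrow>\<^sub>C 'a" and c :: real
    assume "x \<in> {x. (apply_bcontfun x \<longlongrightarrow> 0) \<U>}"
    then show "c *\<^sub>R x \<in> {x. (apply_bcontfun x \<longlongrightarrow> 0) \<U>}"
      using tendsto_scaleR[of "\<lambda>_. c" c \<U> "apply_bcontfun x" 0] by (simp add: scaleR_bcontfun.rep_eq)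
  qed
qed

lemma ultrapower_op_coset:
  "ultrapower_op \<U> T (coset (null_seqs \<U>) x) = coset (null_seqs \<U>) (map_seq (blinfun_apply T) x)"
  unfolding ultrapower_op_def
proof (rule coset_map_coset[OF subspace_null_seqs])
  fix y assume "y - x \<in> null_seqs \<U>"
  then have "((\<lambda>n. apply_bcontfun (y - x) n) \<longlongrightarrow> 0) \<U>"
    by (simp add: null_seqs_def tendsto_norm_zero_iff)
  from blinfun.tendsto[OF tendsto_const this, of T]
  have "((\<lambda>n. blinfun_apply T (apply_bcontfun y n) - blinfun_apply T (apply_bcontfun x n)) \<longlongrightarrow> 0) \<U>"
    by (simp add: blinfun.diff_right minus_bcontfun.rep_eq)
  then show "map_seq (blinfun_apply T) y - map_seq (blinfun_apply T) x \<in> null_seqs \<U>"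
    by (simp add: null_seqs_def minus_bcontfun.rep_eq tendsto_norm_zero_iff apply_map_seq[OF norm_blinfun])
qed

definition super_ergodic_ops :: "('k \<Rightarrow> 'a \<Rightarrow> 'a) \<Rightarrow> ('a::real_normed_vector \<Rightarrow>\<^sub>L 'a) set"
  where "super_ergodic_ops scal = {T \<in> bounded_ops scal.
    \<forall>\<U>. is_ultrafilter \<U> \<longrightarrow>
      ultrapower_op \<U> T \<in> quotient_ergodic_ops (\<lambda>c. map_seq (scal c)) (null_seqs \<U>)}"


section \<open>The ergodic index\<close>

text \<open>Trees live on \<open>\<nat> = {1, 2, \<dots>}\<close>; list positions count from \<open>0\<close>.\<close>

definition ergodic_tree :: "('a::real_normed_vector \<Rightarrow>\<^sub>L 'a) \<Rightarrow> real \<Rightarrow> nat list set"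
  where "ergodic_tree T \<epsilon> = {s. sorted_wrt (<) s \<and> 0 \<notin> set s \<and>
    (length s \<le> 1 \<or>
     (\<exists>x\<in>cball 0 1. \<forall>p. Suc p < length s \<longrightarrow>
        norm (blinfun_apply (cesaro T (s ! p)) x - blinfun_apply (cesaro T (s ! Suc p)) x) > \<epsilon>))}"

definition ergodic_index :: "('a::real_normed_vector \<Rightarrow>\<^sub>L 'a) \<Rightarrow> omega1_ordinal"
  where "ergodic_index T = (SUP \<epsilon>\<in>{0<..}. tree_height (ergodic_tree T \<epsilon>))"

definition space_ergodic_index :: "('k \<Rightarrow> 'a::real_normed_vector \<Rightarrow> 'a) \<Rightarrow> omega1_ordinal"
  where "space_ergodic_index scal = (SUP T\<in>super_ergodic_ops scal. ergodic_index T)"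

end

theory Submission
  imports Defs
begin

text \<open>
  A family of trees over a countable set is of unbounded height at a node \<open>s\<close> when every \<open>\<alpha> < \<omega>\<^sub>1\<close>
  admits a tree of the family whose \<open>\<alpha>\<close>-th derivative contains \<open>s\<close>. As \<open>\<omega>\<^sub>1\<close> has uncountable
  cofinality, this property passes to some piece of every countable cover of the family, and to some
  one-point extension of \<open>s\<close>.

  A common rate of norm convergence of the Cesaro means bounds the length of the nodes in the trees, and
  the uniformly ergodic operators are covered by countably many such rates; so not all super-ergodic
  operators are uniformly ergodic. If all ergodic operators were super-ergodic, one would extend a node
  step by step and at each step pass to a piece on which one more value of the operator (on a dense
  sequence), one more rate of convergence of the Cesaro means, and a witness for the current node are
  fixed up to a small error. Operators chosen from the successive pieces converge strongly to an ergodic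
  operator whose tree has an infinite branch, which is impossible for a super-ergodic operator. This is a
  direct form of the boundedness theorem for coanalytic ranks.
\<close>

section \<open>Countable ordinals and derivatives of trees\<close>

text \<open>Uncountable cofinality of \<open>omega1\<close>: if \<open>A\<close> were cofinal, the
  segments \<open>{..<a}\<close> with \<open>a\<close> in \<open>A\<close>, countably many and each
  countable, would cover all countable ordinals.\<close>

lemma Sup_countable_less_omega1:
  fixes A :: "omega1_ordinal set"
  assumes "countable A" "\<And>a. a \<in> A \<Longrightarrow> a < top"
  shows "Sup A < top"
proof (rule ccontr)
  assume "\<not> Sup A < top"
  then have "Sup A = top" using top.not_eq_extremum by blast
  then have "\<exists>a\<in>A. x < a" if "x < top" for x
    using that less_Sup_iff by metis
  then have "{..<top} \<subseteq> (\<Union>a\<in>A. {..<a})" by auto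
  moreover have "countable (\<Union>a\<in>A. {..<a})"
    using assms countable_lessThan_omega1 by blast
  ultimately show False
    using uncountable_lessThan_omega1 countable_subset by blast
qed

lemma bot_less_omega1: "(bot :: omega1_ordinal) < top"
  using Sup_countable_less_omega1[of "{}"] by simp

text \<open>If the successor were \<open>omega1\<close>, then \<alpha> would be the largest
  countable ordinal, and all countable ordinals would lie in the countable set
  \<open>insert \<alpha> {..<\<alpha>}\<close>.\<close>

lemma ord_suc_less_omega1:
  assumes "\<alpha> < top"
  shows "ord_suc \<alpha> < top"
proof (rule ccontr)
  assume *: "\<not> ord_suc \<alpha> < top"
  have "\<beta> \<le> \<alpha>" if "\<beta> < top" for \<beta>
    using that * not_less_Least[of \<beta> "\<lambda>\<beta>. \<alpha> < \<beta>"] unfolding ord_suc_def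
    by (metis order_less_le_trans linorder_not_less top_greatest)
  then have "{..<top} \<subseteq> insert \<alpha> {..<\<alpha>}"
    by (auto simp: order_le_less)
  moreover have "countable (insert \<alpha> {..<\<alpha>})"
    using countable_lessThan_omega1[OF assms] by simp
  ultimately show False
    using uncountable_lessThan_omega1 countable_subset by blast
qed

lemma le_of_less_ord_suc: "\<beta> < ord_suc \<alpha> \<Longrightarrow> \<beta> \<le> \<alpha>"
  using not_less_Least[of \<beta> "\<lambda>\<beta>. \<alpha> < \<beta>"] unfolding ord_suc_def by (simp only: linorder_not_less)

text \<open>\<open>derived_tree\<close> collects the proper initial segments of members whether or
  not they are members themselves, so a derivative need not be a subset. Closure under initial
  segments makes it one.\<close>

definition prefix_closed :: "'a list set \<Rightarrow> bool"
  where "prefix_closed \<T> \<longleftrightarrow> (\<forall>t\<in>\<T>. \<forall>s. prefix s t \<longrightarrow> s \<in> \<T>)"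

lemma prefix_closed_derived_tree:
  assumes "prefix_closed \<T>"
  shows "prefix_closed (derived_tree \<T>)"
  unfolding prefix_closed_def
proof (intro ballI allI impI)
  fix t s
  assume "t \<in> derived_tree \<T>" "prefix s t"
  then obtain u where "u \<in> \<T>" "strict_prefix t u" unfolding derived_tree_def by blast
  with \<open>prefix s t\<close> have "strict_prefix s u" by (metis prefix_order.le_less_trans)
  with \<open>u \<in> \<T>\<close> show "s \<in> derived_tree \<T>" unfolding derived_tree_def by blast
qed

lemma derived_tree_subset: "prefix_closed \<T> \<Longrightarrow> derived_tree \<T> \<subseteq> \<T>"
  unfolding prefix_closed_def derived_tree_def strict_prefix_def by blast

text \<open>Both properties go through one induction: at a successor the derivative shrinks because
  the previous stage is prefix closed.\<close>

lemma tree_deriv_prefix_closed_antimono: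
  assumes "prefix_closed \<T>"
  shows "prefix_closed (tree_deriv \<T> \<alpha>) \<and> (\<forall>\<beta>\<le>\<alpha>. tree_deriv \<T> \<alpha> \<subseteq> tree_deriv \<T> \<beta>)"
proof (induction \<alpha> rule: less_induct)
  case (less \<alpha>)
  consider "\<alpha> = bot" | \<beta> where "\<beta> < \<alpha>" "ord_suc \<beta> = \<alpha>"
    | "\<alpha> \<noteq> bot" "\<And>\<beta>. \<beta> < \<alpha> \<Longrightarrow> ord_suc \<beta> \<noteq> \<alpha>"
    by blast
  then show ?case
  proof cases
    case 1
    then show ?thesis using assms by (simp add: tree_deriv_zero bot_unique)
  next
    case (2 \<beta>)
    then have "\<beta> < top" by (meson order_less_le_trans top_greatest)
    then have eq: "tree_deriv \<T> \<alpha> = derived_tree (tree_deriv \<T> \<beta>)"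
      using 2 tree_deriv_suc by blast
    have IH: "prefix_closed (tree_deriv \<T> \<beta>)"
      "\<And>\<gamma>. \<gamma> \<le> \<beta> \<Longrightarrow> tree_deriv \<T> \<beta> \<subseteq> tree_deriv \<T> \<gamma>"
      using less.IH[OF 2(1)] by auto
    have "tree_deriv \<T> \<alpha> \<subseteq> tree_deriv \<T> \<gamma>" if "\<gamma> \<le> \<alpha>" for \<gamma>
    proof (cases "\<gamma> = \<alpha>")
      case False
      with that 2 have "\<gamma> \<le> \<beta>" using le_of_less_ord_suc by auto
      then show ?thesis using IH derived_tree_subset eq by blast
    qed simp
    with IH eq show ?thesis by (simp add: prefix_closed_derived_tree)
  next
    case 3
    then have eq: "tree_deriv \<T> \<alpha> = (\<Inter>\<beta>\<in>{..<\<alpha>}. tree_deriv \<T> \<beta>)"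
      by (rule tree_deriv_limit)
    have "prefix_closed (tree_deriv \<T> \<alpha>)"
      unfolding prefix_closed_def
    proof (intro ballI allI impI)
      fix t s assume t: "t \<in> tree_deriv \<T> \<alpha>" "prefix s t"
      have "s \<in> tree_deriv \<T> \<beta>" if "\<beta> < \<alpha>" for \<beta>
      proof -
        have "prefix_closed (tree_deriv \<T> \<beta>)" using less.IH[OF that] ..
        moreover have "t \<in> tree_deriv \<T> \<beta>" using t(1) that unfolding eq by simp
        ultimately show ?thesis using t(2) unfolding prefix_closed_def by blast
      qed
      then show "s \<in> tree_deriv \<T> \<alpha>" unfolding eq by simp
    qed
    moreover have "tree_deriv \<T> \<alpha> \<subseteq> tree_deriv \<T> \<gamma>" if "\<gamma> \<le> \<alpha>" for \<gamma>
    proof (cases "\<gamma> = \<alpha>")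
      case False
      with that show ?thesis unfolding eq by (intro INF_lower) simp
    qed simp
    ultimately show ?thesis by simp
  qed
qed

text \<open>No derivative below the height is empty, and a nonempty prefix closed set contains the
  root. This turns a height into membership of a single node, the form that
  \<open>unbounded_height\<close> tracks.\<close>

lemma Nil_in_tree_deriv:
  assumes "prefix_closed \<T>" "\<alpha> < tree_height \<T>"
  shows "[] \<in> tree_deriv \<T> \<alpha>"
proof -
  have "tree_deriv \<T> \<alpha> \<noteq> {}"
    using assms(2) unfolding tree_height_def
    by (auto split: if_splits dest: not_less_Least)
  then show ?thesis
    using tree_deriv_prefix_closed_antimono[OF assms(1), of \<alpha>]
    by (metis Nil_prefix equals0I prefix_closed_def)
qed

section \<open>Families of trees of unbounded height\<close>

definition unbounded_height :: "('b \<Rightarrow> 'a list set) \<Rightarrow> 'b set \<Rightarrow> 'a list \<Rightarrow> bool"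
  where "unbounded_height \<T> M s \<longleftrightarrow> (\<forall>\<alpha><top. \<exists>b\<in>M. s \<in> tree_deriv (\<T> b) \<alpha>)"

text \<open>If each \<open>c\<close> failed at some stage \<open>f c\<close>, the supremum of these
  countably many stages would still be countable; the \<open>c\<close> supplied by \<open>ex\<close>
  at that stage has \<open>S c\<close> in a derivative contained in the one at \<open>f c\<close>.
  Both family and node depend on \<open>c\<close> in order to serve the splitting of a family
  (\<open>S\<close> constant) and the extension of a node (\<open>M\<close> constant).\<close>

lemma unbounded_height_pigeonhole:
  fixes S :: "'c::countable \<Rightarrow> 'a list"
  assumes closed: "\<And>b. prefix_closed (\<T> b)"
    and ex: "\<And>\<alpha>. \<alpha> < top \<Longrightarrow> \<exists>c. \<exists>b\<in>M c. S c \<in> tree_deriv (\<T> b) \<alpha>"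
  shows "\<exists>c. unbounded_height \<T> (M c) (S c)"
proof (rule ccontr)
  assume "\<nexists>c. unbounded_height \<T> (M c) (S c)"
  then have "\<exists>\<alpha><top. \<forall>b\<in>M c. S c \<notin> tree_deriv (\<T> b) \<alpha>" for c
    unfolding unbounded_height_def by blast
  then obtain f where f: "\<And>c. f c < top" "\<And>c b. b \<in> M c \<Longrightarrow> S c \<notin> tree_deriv (\<T> b) (f c)"
    by metis
  have "Sup (range f) < top"
    using f(1) by (intro Sup_countable_less_omega1) auto
  from ex[OF this] obtain c b where "b \<in> M c" "S c \<in> tree_deriv (\<T> b) (Sup (range f))"
    by blast
  moreover have "f c \<le> Sup (range f)" by (rule Sup_upper) simp
  ultimately show False
    using f(2) tree_deriv_prefix_closed_antimono[OF closed] by blast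
qed

lemma unbounded_height_nonempty: "unbounded_height \<T> M s \<Longrightarrow> M \<noteq> {}"
  unfolding unbounded_height_def by (metis bot_less_omega1 empty_iff)

text \<open>The pieces have to cover only those members whose tree contains \<open>s\<close>, so a
  piece may also record a witness for \<open>s\<close>.\<close>

lemma unbounded_height_cover:
  fixes C :: "'c::countable \<Rightarrow> 'b set"
  assumes "\<And>b. prefix_closed (\<T> b)" "unbounded_height \<T> M s"
    and cover: "\<And>b. b \<in> M \<Longrightarrow> s \<in> \<T> b \<Longrightarrow> \<exists>c. b \<in> C c"
  shows "\<exists>c. unbounded_height \<T> (M \<inter> C c) s"
proof (rule unbounded_height_pigeonhole[where S = "\<lambda>_. s"])
  fix \<alpha> :: omega1_ordinal
  assume "\<alpha> < top"
  with assms(2) obtain b where b: "b \<in> M" "s \<in> tree_deriv (\<T> b) \<alpha>"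
    unfolding unbounded_height_def by blast
  moreover have "s \<in> \<T> b"
    using tree_deriv_prefix_closed_antimono[OF assms(1)[of b], of \<alpha>] b bot_least
    by (metis subsetD tree_deriv_zero)
  ultimately show "\<exists>c. \<exists>b\<in>M \<inter> C c. s \<in> tree_deriv (\<T> b) \<alpha>"
    using cover by blast
qed (rule assms(1))

lemma unbounded_height_extend:
  fixes s :: "'a::countable list"
  assumes "\<And>b. prefix_closed (\<T> b)" "unbounded_height \<T> M s"
  shows "\<exists>a. unbounded_height \<T> M (s @ [a])"
proof (rule unbounded_height_pigeonhole[where S = "\<lambda>a. s @ [a]" and M = "\<lambda>_. M"])
  fix \<alpha> :: omega1_ordinal
  assume \<alpha>: "\<alpha> < top"
  \<comment> \<open>Going one stage higher pays for the extension: a node of the derivative at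
    \<open>ord_suc \<alpha>\<close> has a proper extension in the derivative at \<alpha>, and the
    first new entry is the required \<open>a\<close>.\<close>
  then obtain b where b: "b \<in> M" "s \<in> tree_deriv (\<T> b) (ord_suc \<alpha>)"
    using assms(2) ord_suc_less_omega1 unfolding unbounded_height_def by blast
  then obtain t where t: "t \<in> tree_deriv (\<T> b) \<alpha>" "strict_prefix s t"
    by (auto simp: tree_deriv_suc[OF \<alpha>] derived_tree_def)
  then obtain a u where "t = s @ a # u" by (auto elim: strict_prefixE')
  then have "prefix (s @ [a]) t" by simp
  then have "s @ [a] \<in> tree_deriv (\<T> b) \<alpha>"
    using t tree_deriv_prefix_closed_antimono[OF assms(1)] unfolding prefix_closed_def by blast
  with b show "\<exists>a. \<exists>b\<in>M. s @ [a] \<in> tree_deriv (\<T> b) \<alpha>" by blast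
qed (rule assms(1))

section \<open>Ultrafilters\<close>

lemma is_ultrafilter_principal: "is_ultrafilter (principal {i})"
  by (auto simp: is_ultrafilter_def eventually_principal principal_eq_bot_iff)

text \<open>Zorn's lemma, applied to the proper filters below \<open>F\<close> ordered by
  refinement, gives a minimal one; minimality makes it an ultrafilter.\<close>

lemma exists_ultrafilter_le:
  fixes F :: "'i filter"
  assumes "F \<noteq> bot"
  shows "\<exists>U\<le>F. is_ultrafilter U"
proof -
  let ?A = "{G. G \<le> F \<and> G \<noteq> bot}"
  have "\<exists>U\<in>?A. \<forall>G\<in>?A. G \<le> U \<longrightarrow> G = U"
  proof (rule predicate_Zorn)
    show "partial_order_on ?A (relation_of (\<lambda>G H. H \<le> G) ?A)"
      by (auto simp: partial_order_on_def preorder_on_def refl_on_def trans_def antisym_def relation_of_def)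
  next
    fix C assume C: "C \<in> Chains (relation_of (\<lambda>G H. H \<le> G) ?A)"
    show "\<exists>u\<in>?A. \<forall>a\<in>C. u \<le> a"
    proof (cases "C = {}")
      case True
      then show ?thesis using assms by auto
    next
      case False
      have CA: "C \<subseteq> ?A" and lin: "\<And>G H. G \<in> C \<Longrightarrow> H \<in> C \<Longrightarrow> G \<le> H \<or> H \<le> G"
        using C unfolding Chains_def relation_of_def by blast+
      \<comment> \<open>A property that is eventual for the infimum of a nonempty chain is eventual
        for one member, so the infimum stays proper.\<close>
      have "eventually P (Inf C) \<longleftrightarrow> (\<exists>G\<in>C. eventually P G)" for P
      proof (rule eventually_Inf_base[OF False])
        fix G H assume "G \<in> C" "H \<in> C"
        with lin show "\<exists>x\<in>C. x \<le> inf G H" by (metis inf.order_iff inf.commute order.refl)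
      qed
      then have "Inf C \<noteq> bot"
        using CA by (auto simp: trivial_limit_def)
      moreover obtain G where "G \<in> C" using False by blast
      then have "Inf C \<le> G" "G \<le> F" using CA by (auto intro: Inf_lower)
      then have "Inf C \<le> F" by (rule order_trans)
      ultimately have "Inf C \<in> ?A" by simp
      then show ?thesis by (rule bexI[rotated]) (simp add: Inf_lower)
    qed
  qed
  then obtain U where U: "U \<le> F" "U \<noteq> bot" and min: "\<And>G. G \<le> F \<Longrightarrow> G \<noteq> bot \<Longrightarrow> G \<le> U \<Longrightarrow> G = U"
    by blast
  have "eventually P U \<or> eventually (\<lambda>i. \<not> P i) U" for P
  proof (cases "eventually P U")
    case *: False
    \<comment> \<open>\<open>U\<close> restricted to the complement of \<open>P\<close> is proper,
      since \<open>P\<close> is not eventual; by minimality it is \<open>U\<close> itself.\<close>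
    let ?G = "inf U (principal {i. \<not> P i})"
    have "?G \<noteq> bot"
      using * by (auto simp: trivial_limit_def eventually_inf_principal)
    then have "?G = U" using U by (intro min) (auto intro: le_infI1)
    moreover have "eventually (\<lambda>i. \<not> P i) ?G" by (simp add: eventually_inf_principal)
    ultimately show ?thesis by simp
  qed simp
  with U show ?thesis unfolding is_ultrafilter_def by blast
qed

section \<open>Pointwise bounded sequences of operators\<close>

text \<open>Uniform boundedness by Baire category: the closed sets \<open>E m\<close> cover the
  space, so one of them contains a ball.\<close>

lemma Banach_Steinhaus_sequence:
  fixes A :: "nat \<Rightarrow> 'a::banach \<Rightarrow>\<^sub>L 'b::real_normed_vector"
  assumes "\<And>x. Bseq (\<lambda>n. blinfun_apply (A n) x)"
  shows "\<exists>K. \<forall>n. norm (A n) \<le> K"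
proof -
  define E where "E m = {x. \<forall>n. norm (blinfun_apply (A n) x) \<le> real m}" for m :: nat
  have "closed (E m)" for m
    unfolding E_def by (intro closed_Collect_all closed_Collect_le continuous_intros)
  have "(\<Union>m. E m) = UNIV"
  proof -
    have "\<exists>m. x \<in> E m" for x
    proof -
      obtain K where "\<And>n. norm (blinfun_apply (A n) x) \<le> K"
        using assms[of x] by (meson BseqE)
      moreover obtain m :: nat where "K \<le> real m" using real_arch_simple by blast
      ultimately show ?thesis unfolding E_def by (auto intro: order_trans)
    qed
    then show ?thesis by auto
  qed
  have "\<exists>m. interior (E m) \<noteq> {}"
  proof (rule ccontr)
    assume *: "\<nexists>m. interior (E m) \<noteq> {}"
    have "Met_TC.mtopology interior_of (\<Union>(range E)) = {}"
    proof (rule Met_TC.metric_Baire_category_alt)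
      show "Met_TC.mcomplete TYPE('a)"
        using complete_UNIV by simp
    qed (use * \<open>\<And>m. closed (E m)\<close> in \<open>auto\<close>)
    then show False using \<open>(\<Union>m. E m) = UNIV\<close> by simp
  qed
  then obtain m a r where r: "r > 0" "cball a r \<subseteq> E m"
    by (meson all_not_in_conv mem_interior_cball)
  have "norm (A n) \<le> 2 * real m / r" for n
  proof (rule norm_blinfun_bound)
    fix x
    show "norm (blinfun_apply (A n) x) \<le> 2 * real m / r * norm x"
    proof (cases "x = 0")
      case False
      \<comment> \<open>\<open>x\<close> is rescaled to length \<open>r\<close>, so that
        \<open>a\<close> and \<open>a + y\<close> both lie in the ball; the two bounds
        \<open>m\<close> add up, and division by \<open>r\<close> gives the constant.\<close>
      define y where "y = (r / norm x) *\<^sub>R x"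
      have "a \<in> E m" "a + y \<in> E m"
        using r False by (auto simp: y_def subset_iff dist_norm)
      then have "norm (blinfun_apply (A n) (a + y) - blinfun_apply (A n) a) \<le> real m + real m"
        unfolding E_def by (intro order_trans[OF norm_triangle_ineq4] add_mono) auto
      then have "r / norm x * norm (blinfun_apply (A n) x) \<le> 2 * real m"
        using r by (simp add: y_def blinfun.add_right blinfun.scaleR_right)
      then show ?thesis using r False by (simp add: field_simps)
    qed simp
  qed (use r in simp)
  then show ?thesis by blast
qed

section \<open>Cesaro means and ergodicity\<close>

lemma (in normed_scalars) bounded_linear_scal: "bounded_linear (scal c)"
proof (rule bounded_linear_intro)
  show "scal c (x + y) = scal c x + scal c y" for x y
    by (rule scale_right_distrib)
  show "scal c (r *\<^sub>R x) = r *\<^sub>R scal c x" for r x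
    by (simp flip: scale_of_real add: mult.commute)
  show "norm (scal c x) \<le> norm x * norm c" for x
    by (simp add: norm_scale)
qed

lemma funpow_compose_blinfun_apply:
  fixes T :: "'a::real_normed_vector \<Rightarrow>\<^sub>L 'a"
  shows "blinfun_apply ((blinfun_compose T ^^ k) id_blinfun) x = (blinfun_apply T ^^ k) x"
  by (induction k) simp_all

lemma cesaro_apply:
  "blinfun_apply (cesaro T n) x = (1 / real n) *\<^sub>R (\<Sum>k<n. (blinfun_apply T ^^ k) x)"
  by (simp add: cesaro_def blinfun.scaleR_left blinfun.sum_left funpow_compose_blinfun_apply)

lemma bounded_opsD: "T \<in> bounded_ops scal \<Longrightarrow> blinfun_apply T (scal c x) = scal c (blinfun_apply T x)"
  by (simp add: bounded_ops_def)

lemma (in normed_scalars) cesaro_in_bounded_ops: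
  assumes "T \<in> bounded_ops scal"
  shows "cesaro T n \<in> bounded_ops scal"
proof -
  have "(blinfun_apply T ^^ k) (scal c x) = scal c ((blinfun_apply T ^^ k) x)" for k c x
    by (induction k) (simp_all add: bounded_opsD[OF assms])
  then show ?thesis
    using bounded_linear.linear[OF bounded_linear_scal]
    by (simp add: bounded_ops_def cesaro_apply linear_scale scale_sum_right)
qed

text \<open>The strong operator topology is the pullback of the product topology under
  \<open>blinfun_apply\<close>, and convergence in a product is componentwise.\<close>

lemma limitin_strong_operator_topology:
  "limitin strong_operator_topology A P F \<longleftrightarrow>
    (\<forall>x. ((\<lambda>n. blinfun_apply (A n) x) \<longlongrightarrow> blinfun_apply P x) F)"
proof
  assume "limitin strong_operator_topology A P F"
  then show "\<forall>x. ((\<lambda>n. blinfun_apply (A n) x) \<longlongrightarrow> blinfun_apply P x) F"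
    using continuous_map_limit[OF strong_operator_topology_continuous_evaluation]
    by (fastforce simp: o_def)
next
  assume "\<forall>x. ((\<lambda>n. blinfun_apply (A n) x) \<longlongrightarrow> blinfun_apply P x) F"
  then have "limitin (product_topology (\<lambda>_. euclidean) UNIV) (\<lambda>n. blinfun_apply (A n)) (blinfun_apply P) F"
    by (simp add: limitin_componentwise)
  then show "limitin strong_operator_topology A P F"
    by (auto simp: limitin_def strong_operator_topology_def topspace_pullback_topology
        openin_pullback_topology euclidean_product_topology)
qed

lemma tendsto_in_bounded_ops:
  assumes "normed_scalars scal" "F \<noteq> bot" "\<And>n. A n \<in> bounded_ops scal"
    and lim: "\<And>x. ((\<lambda>n. blinfun_apply (A n) x) \<longlongrightarrow> blinfun_apply P x) F"
  shows "P \<in> bounded_ops scal"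
proof -
  have "blinfun_apply P (scal c x) = scal c (blinfun_apply P x)" for c x
  proof (rule tendsto_unique[OF \<open>F \<noteq> bot\<close> lim])
    show "((\<lambda>n. blinfun_apply (A n) (scal c x)) \<longlongrightarrow> scal c (blinfun_apply P x)) F"
      using bounded_linear.tendsto[OF normed_scalars.bounded_linear_scal[OF assms(1)] lim]
      by (simp add: bounded_opsD[OF assms(3)])
  qed
  then show ?thesis by (simp add: bounded_ops_def)
qed

lemma bounded_Cauchy_blinfun_limit:
  fixes A :: "nat \<Rightarrow> 'a::real_normed_vector \<Rightarrow>\<^sub>L 'b::banach"
  assumes K: "\<And>n. norm (A n) \<le> K" and Cauchy: "\<And>x. Cauchy (\<lambda>n. blinfun_apply (A n) x)"
  obtains P where "norm P \<le> K" "\<And>x. (\<lambda>n. blinfun_apply (A n) x) \<longlonglongrightarrow> blinfun_apply P x"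
proof -
  have "\<forall>x. \<exists>l. (\<lambda>n. blinfun_apply (A n) x) \<longlonglongrightarrow> l"
    using Cauchy_convergent[OF Cauchy] unfolding convergent_def by (rule allI)
  then obtain f where f: "\<And>x. (\<lambda>n. blinfun_apply (A n) x) \<longlonglongrightarrow> f x"
    by (auto dest!: choice)
  have bound: "norm (f x) \<le> norm x * K" for x
  proof (rule LIMSEQ_le_const2[OF tendsto_norm[OF f]])
    have "norm (blinfun_apply (A n) x) \<le> norm x * K" for n
      using norm_blinfun[of "A n" x] mult_right_mono[OF K norm_ge_zero, of n x]
      by (simp add: mult.commute)
    then show "\<exists>N. \<forall>n\<ge>N. norm (blinfun_apply (A n) x) \<le> norm x * K" by blast
  qed
  have "bounded_linear f"
  proof (rule bounded_linear_intro[OF _ _ bound])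
    show "f (x + y) = f x + f y" for x y
      using LIMSEQ_unique[OF f[of "x + y"]] tendsto_add[OF f f, of x y]
      by (simp add: blinfun.add_right)
    show "f (r *\<^sub>R x) = r *\<^sub>R f x" for r x
      using LIMSEQ_unique[OF f[of "r *\<^sub>R x"]] tendsto_scaleR[OF tendsto_const f, of r x]
      by (simp add: blinfun.scaleR_right)
  qed
  then have eq: "blinfun_apply (Blinfun f) = f" by (rule bounded_linear_Blinfun_apply)
  have "norm (Blinfun f) \<le> K"
  proof (rule norm_blinfun_bound)
    show "0 \<le> K" by (rule order_trans[OF norm_ge_zero K])
  qed (use bound eq in \<open>simp add: mult.commute\<close>)
  with f eq show ?thesis by (intro that) auto
qed

text \<open>On a Banach space the limit operator comes for free: pointwise Cauchy means are
  pointwise bounded, hence bounded in norm, and their pointwise limit is a bounded operator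
  commuting with the scalars. What remains is a condition at each point that can be split into
  countably many rates.\<close>

lemma ergodic_ops_iff:
  fixes T :: "'a::banach \<Rightarrow>\<^sub>L 'a"
  assumes "normed_scalars scal"
  shows "T \<in> ergodic_ops scal \<longleftrightarrow>
    T \<in> bounded_ops scal \<and> (\<forall>x. Cauchy (\<lambda>n. blinfun_apply (cesaro T n) x))"
proof
  assume "T \<in> ergodic_ops scal"
  then show "T \<in> bounded_ops scal \<and> (\<forall>x. Cauchy (\<lambda>n. blinfun_apply (cesaro T n) x))"
    by (auto simp: ergodic_ops_def limitin_strong_operator_topology intro: LIMSEQ_imp_Cauchy)
next
  assume T: "T \<in> bounded_ops scal \<and> (\<forall>x. Cauchy (\<lambda>n. blinfun_apply (cesaro T n) x))"
  then obtain K where "\<And>n. norm (cesaro T n) \<le> K"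
    using Banach_Steinhaus_sequence[of "cesaro T"] Cauchy_Bseq by blast
  then obtain P where P: "\<And>x. (\<lambda>n. blinfun_apply (cesaro T n) x) \<longlonglongrightarrow> blinfun_apply P x"
    using T bounded_Cauchy_blinfun_limit[of "cesaro T"] by blast
  have "cesaro T n \<in> bounded_ops scal" for n
    using T normed_scalars.cesaro_in_bounded_ops[OF assms] by simp
  then have "P \<in> bounded_ops scal"
    using P by (rule tendsto_in_bounded_ops[OF assms sequentially_bot])
  moreover have "limitin strong_operator_topology (cesaro T) P sequentially"
    using P by (simp add: limitin_strong_operator_topology)
  ultimately show "T \<in> ergodic_ops scal"
    using T unfolding ergodic_ops_def by blast
qed

lemma ergodic_ops_bounded_cesaro:
  fixes T :: "'a::banach \<Rightarrow>\<^sub>L 'a"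
  assumes "normed_scalars scal" "T \<in> ergodic_ops scal"
  shows "\<exists>K. \<forall>n. norm (cesaro T n) \<le> K"
proof (rule Banach_Steinhaus_sequence)
  fix x
  show "Bseq (\<lambda>n. blinfun_apply (cesaro T n) x)"
    using assms(2) unfolding ergodic_ops_iff[OF assms(1)] by (blast intro: Cauchy_Bseq)
qed

lemma bounded_Cauchy_dense:
  fixes A :: "nat \<Rightarrow> 'a::real_normed_vector \<Rightarrow>\<^sub>L 'b::real_normed_vector"
  assumes K: "\<And>n. norm (A n) \<le> K" and dense: "closure D = UNIV"
    and Cauchy: "\<And>d. d \<in> D \<Longrightarrow> Cauchy (\<lambda>n. blinfun_apply (A n) d)"
  shows "Cauchy (\<lambda>n. blinfun_apply (A n) x)"
proof (rule metric_CauchyI)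
  fix e :: real assume "e > 0"
  have "0 \<le> K" by (rule order_trans[OF norm_ge_zero K])
  \<comment> \<open>\<open>K + 1\<close> keeps the denominator positive when \<open>K = 0\<close>;
    the two approximation errors and the Cauchy error take a third of \<open>e\<close> each.\<close>
  define r where "r = e / (3 * (K + 1))"
  have "r > 0" using \<open>e > 0\<close> \<open>0 \<le> K\<close> by (simp add: r_def)
  then obtain d where d: "d \<in> D" "dist d x < r"
    using dense closure_approachable[of x D] by auto
  have near: "dist (blinfun_apply (A n) d) (blinfun_apply (A n) x) \<le> e / 3" for n
  proof -
    have "dist (blinfun_apply (A n) d) (blinfun_apply (A n) x) \<le> norm (A n) * dist d x"
      using norm_blinfun[of "A n" "d - x"] by (simp add: dist_norm blinfun.diff_right)
    also have "\<dots> \<le> (K + 1) * r"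
      using K[of n] d(2) \<open>0 \<le> K\<close> by (intro mult_mono) auto
    also have "\<dots> = e / 3" using \<open>0 \<le> K\<close> by (simp add: r_def field_simps)
    finally show ?thesis .
  qed
  obtain N where N: "\<And>m n. m \<ge> N \<Longrightarrow> n \<ge> N \<Longrightarrow> dist (blinfun_apply (A m) d) (blinfun_apply (A n) d) < e / 3"
    using Cauchy[OF d(1)] \<open>e > 0\<close> unfolding Cauchy_def by (meson divide_pos_pos zero_less_numeral)
  have "dist (blinfun_apply (A m) x) (blinfun_apply (A n) x) < e" if "m \<ge> N" "n \<ge> N" for m n
    using N[OF that] near[of m] near[of n]
      dist_triangle[of "blinfun_apply (A m) x" "blinfun_apply (A n) x" "blinfun_apply (A m) d"]
      dist_triangle[of "blinfun_apply (A m) d" "blinfun_apply (A n) x" "blinfun_apply (A n) d"]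
    by (simp add: dist_commute)
  then show "\<exists>N. \<forall>m\<ge>N. \<forall>n\<ge>N. dist (blinfun_apply (A m) x) (blinfun_apply (A n) x) < e" by blast
qed

text \<open>Composition respects strong convergence under a common norm bound: the next power of
  \<open>T k\<close> at \<open>x\<close> is \<open>T k\<close> applied to a null sequence plus
  \<open>T k\<close> applied to the fixed vector \<open>?y\<close>.\<close>

lemma cesaro_tendsto:
  fixes T :: "nat \<Rightarrow> 'a::real_normed_vector \<Rightarrow>\<^sub>L 'a"
  assumes K: "\<And>k. norm (T k) \<le> K"
    and lim: "\<And>x. (\<lambda>k. blinfun_apply (T k) x) \<longlonglongrightarrow> blinfun_apply S x"
  shows "(\<lambda>k. blinfun_apply (cesaro (T k) n) x) \<longlonglongrightarrow> blinfun_apply (cesaro S n) x"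
proof -
  have "(\<lambda>k. (blinfun_apply (T k) ^^ m) x) \<longlonglongrightarrow> (blinfun_apply S ^^ m) x" for m
  proof (induction m)
    case (Suc m)
    let ?y = "(blinfun_apply S ^^ m) x"
    have "(\<lambda>k. blinfun_apply (T k) ((blinfun_apply (T k) ^^ m) x - ?y)) \<longlonglongrightarrow> 0"
    proof (rule Lim_null_comparison)
      show "\<forall>\<^sub>F k in sequentially. norm (blinfun_apply (T k) ((blinfun_apply (T k) ^^ m) x - ?y))
          \<le> K * norm ((blinfun_apply (T k) ^^ m) x - ?y)"
        using norm_blinfun mult_right_mono[OF K norm_ge_zero] order_trans
        by (intro always_eventually allI) blast
      show "(\<lambda>k. K * norm ((blinfun_apply (T k) ^^ m) x - ?y)) \<longlonglongrightarrow> 0"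
        using Suc LIM_zero tendsto_norm_zero tendsto_mult_right_zero by blast
    qed
    from tendsto_add[OF this lim[of ?y]] show ?case
      by (simp add: blinfun.diff_right)
  qed simp
  then show ?thesis
    unfolding cesaro_apply by (intro tendsto_intros)
qed

section \<open>Operators on ultrapowers\<close>

lemma apply_map_seq_blinfun [simp]:
  "apply_bcontfun (map_seq (blinfun_apply T) x) n = blinfun_apply T (apply_bcontfun x n)"
  by (rule apply_map_seq[OF norm_blinfun])

lemma norm_map_seq_blinfun: "norm (map_seq (blinfun_apply T) x) \<le> norm T * norm x"
proof (rule norm_bound)
  fix n
  show "norm (apply_bcontfun (map_seq (blinfun_apply T) x) n) \<le> norm T * norm x"
    using norm_blinfun[of T "apply_bcontfun x n"] mult_left_mono[OF norm_bounded[of x n] norm_ge_zero[of T]]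
    by simp
qed

section \<open>Cosets and the quotient norm\<close>

lemma coset_in_quotient_space [simp]: "coset C x \<in> quotient_space C"
  by (simp add: quotient_space_def)

lemma quotient_spaceE:
  assumes "A \<in> quotient_space C"
  obtains x where "A = coset C x"
  using assms by (auto simp: quotient_space_def)

lemma mem_coset_self: "subspace C \<Longrightarrow> x \<in> coset C x"
  by (simp add: coset_def subspace_0)

lemma quotient_norm_le: "x \<in> A \<Longrightarrow> quotient_norm A \<le> norm x"
  unfolding quotient_norm_def by (rule cINF_lower) (auto intro: bdd_belowI2[of _ 0])

lemma quotient_norm_nonneg: "A \<noteq> {} \<Longrightarrow> 0 \<le> quotient_norm A"
  unfolding quotient_norm_def by (rule cINF_greatest) auto

lemma quotient_norm_lessE:
  assumes "A \<noteq> {}" "quotient_norm A < e"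
  obtains x where "x \<in> A" "norm x < e"
proof -
  have "bdd_below (norm ` A)" by (auto intro: bdd_belowI2[of _ 0])
  then show ?thesis
    using assms that unfolding quotient_norm_def by (auto simp: cINF_less_iff)
qed

lemma coset_map2_add:
  assumes "subspace C"
  shows "coset_map2 C (+) (coset C x) (coset C y) = coset C (x + y)"
proof (rule coset_map2_coset[OF assms])
  fix x' y' assume "x' - x \<in> C" "y' - y \<in> C"
  from subspace_add[OF assms this] show "x' + y' - (x + y) \<in> C"
    by (simp add: algebra_simps)
qed

lemma coset_map2_diff:
  assumes "subspace C"
  shows "coset_map2 C (-) (coset C x) (coset C y) = coset C (x - y)"
proof (rule coset_map2_coset[OF assms])
  fix x' y' assume "x' - x \<in> C" "y' - y \<in> C"
  from subspace_diff[OF assms this] show "x' - y' - (x - y) \<in> C"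
    by (simp add: algebra_simps)
qed

lemma coset_map_scaleR:
  assumes "subspace C"
  shows "coset_map C (scaleR r) (coset C x) = coset C (r *\<^sub>R x)"
proof (rule coset_map_coset[OF assms])
  fix y assume "y - x \<in> C"
  from subspace_scale[OF assms this] show "r *\<^sub>R y - r *\<^sub>R x \<in> C"
    by (simp add: scaleR_right_diff_distrib)
qed

section \<open>Iterates and Cesaro means on ultrapowers\<close>

lemma apply_bcontfun_sum: "apply_bcontfun (\<Sum>k<n. f k) i = (\<Sum>k<(n::nat). apply_bcontfun (f k) i)"
  by (induction n) simp_all

lemma funpow_ultrapower_op_coset:
  "(ultrapower_op \<U> T ^^ k) (coset (null_seqs \<U>) x) =
    coset (null_seqs \<U>) ((map_seq (blinfun_apply T) ^^ k) x)"
  by (induction k) (simp_all add: ultrapower_op_coset)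

lemma apply_funpow_map_seq:
  "apply_bcontfun ((map_seq (blinfun_apply T) ^^ k) x) i = (blinfun_apply T ^^ k) (apply_bcontfun x i)"
  by (induction k) simp_all

lemma quotient_orbit_sum_ultrapower_op:
  "quotient_orbit_sum (null_seqs \<U>) (ultrapower_op \<U> T) (coset (null_seqs \<U>) x) n =
    coset (null_seqs \<U>) (\<Sum>k<n. (map_seq (blinfun_apply T) ^^ k) x)"
  by (induction n) (simp_all add: funpow_ultrapower_op_coset coset_map2_add subspace_null_seqs)

lemma quotient_cesaro_ultrapower_op:
  "quotient_cesaro (null_seqs \<U>) (ultrapower_op \<U> T) n (coset (null_seqs \<U>) x) =
    coset (null_seqs \<U>) (map_seq (blinfun_apply (cesaro T n)) x)"
proof -
  have "(1 / real n) *\<^sub>R (\<Sum>k<n. (map_seq (blinfun_apply T) ^^ k) x) =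
      map_seq (blinfun_apply (cesaro T n)) x"
    by (rule bcontfun_eqI)
      (simp add: apply_bcontfun_sum apply_funpow_map_seq cesaro_apply)
  then show ?thesis
    by (simp add: quotient_cesaro_def quotient_orbit_sum_ultrapower_op coset_map_scaleR subspace_null_seqs)
qed

lemma ultrapower_op_in_quotient_bounded_ops:
  assumes "normed_scalars scal" "T \<in> bounded_ops scal"
  shows "ultrapower_op \<U> T \<in> quotient_bounded_ops (\<lambda>c. map_seq (scal c)) (null_seqs \<U>)"
proof -
  let ?C = "null_seqs \<U>"
  \<comment> \<open>Multiplication by \<open>c\<close> is a bounded real-linear operator, so on
    cosets it is the ultrapower operator of \<open>Blinfun (scal c)\<close>.\<close>
  have scal: "coset_map ?C (map_seq (scal c)) (coset ?C x) = coset ?C (map_seq (scal c) x)" for c x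
    using ultrapower_op_coset[of \<U> "Blinfun (scal c)" x]
    by (simp add: ultrapower_op_def bounded_linear_Blinfun_apply normed_scalars.bounded_linear_scal[OF assms(1)])
  have apply_scal: "apply_bcontfun (map_seq (scal c) x) n = scal c (apply_bcontfun x n)" for c x n
    using apply_map_seq_blinfun[of "Blinfun (scal c)"]
    by (simp add: bounded_linear_Blinfun_apply normed_scalars.bounded_linear_scal[OF assms(1)])
  have "quotient_norm (ultrapower_op \<U> T (coset ?C x)) \<le> (norm T + 1) * quotient_norm (coset ?C x)" for x
  proof -
    \<comment> \<open>The added 1 makes the constant positive, so one may divide by it; the estimate
      is then checked for each representative \<open>y\<close> of the coset, whose image represents
      the image coset.\<close>
    have pos: "0 < norm T + 1" by (simp add: add_nonneg_pos)
    have "quotient_norm (ultrapower_op \<U> T (coset ?C x)) / (norm T + 1) \<le> quotient_norm (coset ?C x)"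
      unfolding quotient_norm_def[of "coset ?C x"]
    proof (rule cINF_greatest)
      show "coset ?C x \<noteq> {}" using mem_coset_self[OF subspace_null_seqs] by blast
      fix y assume "y \<in> coset ?C x"
      then have "coset ?C x = coset ?C y"
        unfolding coset_eq_iff[OF subspace_null_seqs]
        using subspace_neg[OF subspace_null_seqs, of "y - x"] by (simp add: coset_def)
      then have "quotient_norm (ultrapower_op \<U> T (coset ?C x)) \<le> norm (map_seq (blinfun_apply T) y)"
        by (simp add: ultrapower_op_coset quotient_norm_le mem_coset_self subspace_null_seqs)
      also have "\<dots> \<le> (norm T + 1) * norm y"
        using norm_map_seq_blinfun[of T y] by (simp add: algebra_simps add_increasing)
      finally show "quotient_norm (ultrapower_op \<U> T (coset ?C x)) / (norm T + 1) \<le> norm y"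
        using pos by (simp only: pos_divide_le_eq mult.commute)
    qed
    then show ?thesis using pos by (simp only: pos_divide_le_eq mult.commute)
  qed
  then have "\<exists>K. \<forall>A\<in>quotient_space ?C. quotient_norm (ultrapower_op \<U> T A) \<le> K * quotient_norm A"
    by (metis quotient_spaceE)
  moreover have "map_seq (blinfun_apply T) (x + y) = map_seq (blinfun_apply T) x + map_seq (blinfun_apply T) y" for x y
    by (rule bcontfun_eqI) (simp add: blinfun.add_right)
  moreover have "map_seq (blinfun_apply T) (map_seq (scal c) x) = map_seq (scal c) (map_seq (blinfun_apply T) x)" for c x
    by (rule bcontfun_eqI) (simp add: apply_scal bounded_opsD[OF assms(2)])
  ultimately show ?thesis
    by (auto simp: quotient_bounded_ops_def scal ultrapower_op_coset coset_map2_add subspace_null_seqs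
        elim!: quotient_spaceE)
qed

section \<open>Super-ergodic operators\<close>

text \<open>Some representative \<open>y\<close> has supremum norm below \<open>e\<close>; it
  differs from \<open>x\<close> by a sequence that is null along \<open>\<U>\<close> and so
  eventually smaller than the gap \<open>e - norm y\<close>.\<close>

lemma eventually_norm_less_of_quotient_norm:
  assumes "quotient_norm (coset (null_seqs \<U>) x) < e"
  shows "\<forall>\<^sub>F i in \<U>. norm (apply_bcontfun x i) < e"
proof -
  have "coset (null_seqs \<U>) x \<noteq> {}" using mem_coset_self[OF subspace_null_seqs] by blast
  from quotient_norm_lessE[OF this assms] obtain y where y: "y \<in> coset (null_seqs \<U>) x" "norm y < e"
    by blast
  have "((\<lambda>i. norm (apply_bcontfun y i - apply_bcontfun x i)) \<longlongrightarrow> 0) \<U>"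
    using y(1) by (simp add: coset_def null_seqs_def)
  then have "\<forall>\<^sub>F i in \<U>. norm (apply_bcontfun y i - apply_bcontfun x i) < e - norm y"
    by (rule order_tendstoD) (use y(2) in simp)
  then show ?thesis
  proof eventually_elim
    case (elim i)
    then show ?case
      using norm_bounded[of y i] norm_triangle_sub[of "apply_bcontfun x i" "apply_bcontfun y i"]
      by (simp add: norm_minus_commute)
  qed
qed

text \<open>Both means are compared with a representative \<open>p\<close> of the limit coset. The
  set of indices \<open>i\<close> may depend on \<open>m\<close> and \<open>n\<close>, but
  \<open>N\<close> does not depend on \<open>i\<close>; this uniformity is what excludes an infinite
  branch.\<close>

lemma super_ergodic_ops_eventually_Cauchy:
  fixes \<U> :: "nat filter"
  assumes "T \<in> super_ergodic_ops scal" "is_ultrafilter \<U>" "e > 0"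
  shows "\<exists>N. \<forall>m\<ge>N. \<forall>n\<ge>N. \<forall>\<^sub>F i in \<U>.
    norm (blinfun_apply (cesaro T m) (apply_bcontfun x i) - blinfun_apply (cesaro T n) (apply_bcontfun x i)) < e"
proof -
  let ?C = "null_seqs \<U>"
  have "ultrapower_op \<U> T \<in> quotient_ergodic_ops (\<lambda>c. map_seq (scal c)) ?C"
    using assms unfolding super_ergodic_ops_def by blast
  then obtain P where P: "P \<in> quotient_bounded_ops (\<lambda>c. map_seq (scal c)) ?C"
    and lim: "\<And>A. A \<in> quotient_space ?C \<Longrightarrow>
      (\<lambda>n. quotient_norm (coset_map2 ?C (-) (quotient_cesaro ?C (ultrapower_op \<U> T) n A) (P A))) \<longlonglongrightarrow> 0"
    unfolding quotient_ergodic_ops_def by blast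
  have "P (coset ?C x) \<in> quotient_space ?C"
    using P by (auto simp: quotient_bounded_ops_def)
  then obtain p where p: "P (coset ?C x) = coset ?C p" by (rule quotient_spaceE)
  have "(\<lambda>n. quotient_norm (coset ?C (map_seq (blinfun_apply (cesaro T n)) x - p))) \<longlonglongrightarrow> 0"
    using lim[of "coset ?C x"]
    by (simp add: p quotient_cesaro_ultrapower_op coset_map2_diff subspace_null_seqs)
  then have "\<forall>\<^sub>F n in sequentially. quotient_norm (coset ?C (map_seq (blinfun_apply (cesaro T n)) x - p)) < e / 2"
    by (rule order_tendstoD) (use \<open>e > 0\<close> in simp)
  then obtain N where N: "\<And>n. n \<ge> N \<Longrightarrow> quotient_norm (coset ?C (map_seq (blinfun_apply (cesaro T n)) x - p)) < e / 2"
    by (auto simp: eventually_sequentially)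
  have "\<forall>\<^sub>F i in \<U>. norm (blinfun_apply (cesaro T m) (apply_bcontfun x i)
      - blinfun_apply (cesaro T n) (apply_bcontfun x i)) < e" if "m \<ge> N" "n \<ge> N" for m n
    using eventually_norm_less_of_quotient_norm[OF N[OF that(1)]]
      eventually_norm_less_of_quotient_norm[OF N[OF that(2)]]
  proof eventually_elim
    case (elim i)
    then show ?case
      using norm_triangle_ineq4[of "blinfun_apply (cesaro T m) (apply_bcontfun x i) - apply_bcontfun p i"
          "blinfun_apply (cesaro T n) (apply_bcontfun x i) - apply_bcontfun p i"]
      by simp
  qed
  then show ?thesis by blast
qed

text \<open>The ultrapower of the norm limit \<open>P\<close> is the limit on every ultrapower,
  because the error at the coset of \<open>x\<close> is at most
  \<open>norm (cesaro T n - P) * norm x\<close>.\<close>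

lemma uniformly_ergodic_imp_super_ergodic:
  assumes "normed_scalars scal" "T \<in> uniformly_ergodic_ops scal"
  shows "T \<in> super_ergodic_ops scal"
proof -
  obtain P where T: "T \<in> bounded_ops scal" and P: "P \<in> bounded_ops scal" "cesaro T \<longlonglongrightarrow> P"
    using assms(2) unfolding uniformly_ergodic_ops_def by blast
  have "ultrapower_op \<U> T \<in> quotient_ergodic_ops (\<lambda>c. map_seq (scal c)) (null_seqs \<U>)" for \<U>
  proof -
    let ?C = "null_seqs \<U>"
    have "(\<lambda>n. quotient_norm (coset_map2 ?C (-) (quotient_cesaro ?C (ultrapower_op \<U> T) n A) (ultrapower_op \<U> P A))) \<longlonglongrightarrow> 0"
      if A: "A \<in> quotient_space ?C" for A
    proof -
      obtain x where x: "A = coset ?C x" using A by (rule quotient_spaceE)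
      define q where
        "q n = quotient_norm (coset ?C (map_seq (blinfun_apply (cesaro T n)) x - map_seq (blinfun_apply P) x))" for n
      have upper: "q n \<le> norm (cesaro T n - P) * norm x" for n
      proof -
        have "map_seq (blinfun_apply (cesaro T n)) x - map_seq (blinfun_apply P) x =
            map_seq (blinfun_apply (cesaro T n - P)) x"
          by (rule bcontfun_eqI) (simp add: blinfun.diff_left)
        then have "q n \<le> norm (map_seq (blinfun_apply (cesaro T n - P)) x)"
          by (simp add: q_def quotient_norm_le mem_coset_self subspace_null_seqs)
        also have "\<dots> \<le> norm (cesaro T n - P) * norm x" by (rule norm_map_seq_blinfun)
        finally show ?thesis .
      qed
      have lower: "0 \<le> q n" for n
        unfolding q_def using mem_coset_self[OF subspace_null_seqs] by (intro quotient_norm_nonneg) blast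
      have "q \<longlonglongrightarrow> 0"
      proof (rule tendsto_sandwich[OF _ _ tendsto_const])
        show "\<forall>\<^sub>F n in sequentially. 0 \<le> q n" by (rule always_eventually) (rule allI, rule lower)
        show "\<forall>\<^sub>F n in sequentially. q n \<le> norm (cesaro T n - P) * norm x"
          by (rule always_eventually) (rule allI, rule upper)
        show "(\<lambda>n. norm (cesaro T n - P) * norm x) \<longlonglongrightarrow> 0"
          using P(2) by (intro tendsto_mult_left_zero tendsto_norm_zero LIM_zero)
      qed
      moreover have "quotient_norm (coset_map2 ?C (-) (quotient_cesaro ?C (ultrapower_op \<U> T) n A) (ultrapower_op \<U> P A)) = q n" for n
        unfolding x quotient_cesaro_ultrapower_op ultrapower_op_coset coset_map2_diff[OF subspace_null_seqs] q_def ..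
      ultimately show ?thesis by (simp only:)
    qed
    then have "\<forall>A\<in>quotient_space ?C.
      (\<lambda>n. quotient_norm (coset_map2 ?C (-) (quotient_cesaro ?C (ultrapower_op \<U> T) n A) (ultrapower_op \<U> P A))) \<longlonglongrightarrow> 0"
      by (rule ballI)
    then show ?thesis
      unfolding quotient_ergodic_ops_def
      using ultrapower_op_in_quotient_bounded_ops[OF assms(1) T] ultrapower_op_in_quotient_bounded_ops[OF assms(1) P(1)]
      by (intro CollectI conjI bexI[of _ "ultrapower_op \<U> P"])
  qed
  with T show ?thesis unfolding super_ergodic_ops_def by (intro CollectI conjI allI impI)
qed

lemma super_ergodic_imp_ergodic:
  fixes T :: "'a::banach \<Rightarrow>\<^sub>L 'a"
  assumes "normed_scalars scal" "T \<in> super_ergodic_ops scal"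
  shows "T \<in> ergodic_ops scal"
  unfolding ergodic_ops_iff[OF assms(1)]
proof (intro conjI allI)
  show "T \<in> bounded_ops scal" using assms(2) by (simp add: super_ergodic_ops_def)
  fix x
  show "Cauchy (\<lambda>n. blinfun_apply (cesaro T n) x)"
  proof (rule CauchyI)
    fix e :: real assume "e > 0"
    \<comment> \<open>Along the principal ultrafilter at 0, eventually means at index 0, so a
      constant sequence gives back the Cauchy condition at \<open>x\<close>.\<close>
    from super_ergodic_ops_eventually_Cauchy[OF assms(2) is_ultrafilter_principal[of 0] this, of "const_bcontfun x"]
    show "\<exists>N. \<forall>m\<ge>N. \<forall>n\<ge>N. norm (blinfun_apply (cesaro T m) x - blinfun_apply (cesaro T n) x) < e"
      by (simp add: eventually_principal)
  qed
qed

text \<open>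
  Witnesses for longer and longer initial segments of a branch form a point of the ultrapower
  whose Cesaro means oscillate along the whole branch.
\<close>

lemma super_ergodic_no_branch:
  assumes "T \<in> super_ergodic_ops scal" "e > 0"
  shows "\<not> (\<forall>k. map s [0..<k] \<in> ergodic_tree T e)"
proof
  assume branch: "\<forall>k. map s [0..<k] \<in> ergodic_tree T e"
  have "s i < s (Suc i)" for i
  proof -
    have "sorted_wrt (<) (map s [0..<Suc (Suc i)])"
      using branch unfolding ergodic_tree_def by blast
    then show ?thesis
      unfolding sorted_wrt_iff_nth_less by (auto dest!: spec[of _ i] simp del: upt_Suc)
  qed
  then have s: "strict_mono s" by (simp add: strict_mono_Suc_iff)
  have "\<exists>x. norm x \<le> 1 \<and> (\<forall>p. Suc p < k \<longrightarrow>
      e < norm (blinfun_apply (cesaro T (s p)) x - blinfun_apply (cesaro T (s (Suc p))) x))" for k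
  proof (cases "k \<le> 1")
    case True
    then show ?thesis by (intro exI[of _ 0]) simp
  next
    case False
    have "map s [0..<k] \<in> ergodic_tree T e" using branch by blast
    with False obtain x where "x \<in> cball 0 1" "\<forall>p. Suc p < k \<longrightarrow>
      e < norm (blinfun_apply (cesaro T (map s [0..<k] ! p)) x - blinfun_apply (cesaro T (map s [0..<k] ! Suc p)) x)"
      unfolding ergodic_tree_def by auto
    then show ?thesis by (intro exI[of _ x]) (simp add: Suc_lessD)
  qed
  then obtain x where x: "\<And>k. norm (x k) \<le> 1" "\<And>k p. Suc p < k \<Longrightarrow>
      e < norm (blinfun_apply (cesaro T (s p)) (x k) - blinfun_apply (cesaro T (s (Suc p))) (x k))"
    by metis
  have "x \<in> bcontfun" using x(1) by (intro bcontfun_normI) auto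
  then have Bx: "apply_bcontfun (Bcontfun x) = x" by (rule Bcontfun_inverse)
  obtain U :: "nat filter" where U: "U \<le> sequentially" "is_ultrafilter U"
    using exists_ultrafilter_le[OF sequentially_bot] by blast
  from super_ergodic_ops_eventually_Cauchy[OF assms(1) U(2) assms(2), of "Bcontfun x"]
  obtain N where N: "\<And>m n. m \<ge> N \<Longrightarrow> n \<ge> N \<Longrightarrow>
      \<forall>\<^sub>F k in U. norm (blinfun_apply (cesaro T m) (x k) - blinfun_apply (cesaro T n) (x k)) < e"
    unfolding Bx by blast
  \<comment> \<open>Entries of a strictly increasing sequence dominate their positions, so the jump
    at position \<open>N\<close> lies within the range of the Cauchy condition. \<open>x k\<close>
    shows this jump for all \<open>k > Suc N\<close>, which is eventual along \<open>U\<close> since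
    \<open>U\<close> refines \<open>sequentially\<close>.\<close>
  have "N \<le> s N" "N \<le> s (Suc N)"
    using strict_mono_imp_increasing[OF s] Suc_leD by blast+
  from N[OF this] have "\<forall>\<^sub>F k in U. norm (blinfun_apply (cesaro T (s N)) (x k) - blinfun_apply (cesaro T (s (Suc N))) (x k)) < e" .
  moreover have "\<forall>\<^sub>F k in U. Suc N < k"
    using eventually_gt_at_top[of "Suc N"] U(1) by (rule filter_leD[rotated])
  ultimately have "\<forall>\<^sub>F k in U. False"
  proof eventually_elim
    case (elim k)
    with x(2)[of N k] show ?case by simp
  qed
  then show False using U(2) by (simp add: is_ultrafilter_def)
qed

section \<open>Bounds on the ergodic index\<close>

lemma prefix_closed_ergodic_tree: "prefix_closed (ergodic_tree T e)"
  unfolding prefix_closed_def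
proof (intro ballI allI impI)
  fix t s assume t: "t \<in> ergodic_tree T e" and "prefix s t"
  then obtain u where u: "t = s @ u" by (auto simp: prefix_def)
  have "length s \<le> 1 \<or> (\<exists>x\<in>cball 0 1. \<forall>p. Suc p < length s \<longrightarrow>
      norm (blinfun_apply (cesaro T (s ! p)) x - blinfun_apply (cesaro T (s ! Suc p)) x) > e)"
  proof (cases "length t \<le> 1")
    case False
    then obtain x where x: "x \<in> cball 0 1" "\<And>p. Suc p < length t \<Longrightarrow>
      norm (blinfun_apply (cesaro T (t ! p)) x - blinfun_apply (cesaro T (t ! Suc p)) x) > e"
      using t unfolding ergodic_tree_def by blast
    have "norm (blinfun_apply (cesaro T (s ! p)) x - blinfun_apply (cesaro T (s ! Suc p)) x) > e"
      if "Suc p < length s" for p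
      using x(2)[of p] that by (simp add: u nth_append)
    with x(1) show ?thesis by blast
  qed (simp add: u)
  moreover have "sorted_wrt (<) s" "0 \<notin> set s"
    using t by (auto simp: ergodic_tree_def u sorted_wrt_append)
  ultimately show "s \<in> ergodic_tree T e" unfolding ergodic_tree_def by blast
qed

lemma unbounded_height_mem:
  assumes "unbounded_height \<T> M s"
  shows "\<exists>b\<in>M. s \<in> \<T> b"
proof -
  obtain b where "b \<in> M" "s \<in> tree_deriv (\<T> b) bot"
    using assms bot_less_omega1 unfolding unbounded_height_def by blast
  then show ?thesis unfolding tree_deriv_zero by blast
qed

text \<open>Indexing by pairs merges the two suprema of the index, over the operator and over its
  \<epsilon>, into one family.\<close>

abbreviation ergodic_trees :: "('a::real_normed_vector \<Rightarrow>\<^sub>L 'a) \<times> real \<Rightarrow> nat list set"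
  where "ergodic_trees b \<equiv> ergodic_tree (fst b) (snd b)"

text \<open>A countable \<alpha> lies below the iterated supremum, hence below the height of one of
  the trees, whose root then survives \<alpha> derivations.\<close>

lemma unbounded_height_of_space_ergodic_index:
  assumes "space_ergodic_index scal = omega1"
  shows "unbounded_height ergodic_trees (super_ergodic_ops scal \<times> {0<..}) []"
  unfolding unbounded_height_def
proof (intro allI impI)
  fix \<alpha> :: omega1_ordinal assume "\<alpha> < top"
  then have "\<alpha> < space_ergodic_index scal" using assms by simp
  then obtain T e where T: "T \<in> super_ergodic_ops scal" "e > 0" "\<alpha> < tree_height (ergodic_tree T e)"
    unfolding space_ergodic_index_def ergodic_index_def less_SUP_iff by auto
  from Nil_in_tree_deriv[OF prefix_closed_ergodic_tree T(3)] T(1,2)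
  show "\<exists>b\<in>super_ergodic_ops scal \<times> {0<..}. [] \<in> tree_deriv (ergodic_trees b) \<alpha>"
    by (intro bexI[of _ "(T, e)"]) simp_all
qed

section \<open>Super-ergodic operators that are not uniformly ergodic\<close>

lemma strict_sorted_nth_ge:
  fixes s :: "nat list"
  assumes "sorted_wrt (<) s" "p < length s"
  shows "p \<le> s ! p"
  using assms(2)
proof (induction p)
  case (Suc p)
  have "s ! p < s ! Suc p" using assms(1) Suc.prems by (simp add: sorted_wrt_iff_nth_less)
  with Suc show ?case by simp
qed simp

text \<open>In a piece with a common \<open>N\<close> no tree has a node of length
  \<open>N + 2\<close>, whereas repeated extension of the root yields nodes of every length at which
  the piece has unbounded height.\<close>

lemma exists_super_ergodic_not_uniformly_ergodic:
  fixes scal :: "'k \<Rightarrow> 'a::real_normed_vector \<Rightarrow> 'a"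
  assumes "space_ergodic_index scal = omega1"
  shows "\<not> super_ergodic_ops scal \<subseteq> uniformly_ergodic_ops scal"
proof
  assume sub: "super_ergodic_ops scal \<subseteq> uniformly_ergodic_ops scal"
  \<comment> \<open>Each pair is tested at its own \<open>e\<close>, so a single natural number
    indexes the cover.\<close>
  define C :: "nat \<Rightarrow> (('a \<Rightarrow>\<^sub>L 'a) \<times> real) set"
    where "C N = {(T, e). \<forall>m\<ge>N. \<forall>n\<ge>N. norm (cesaro T m - cesaro T n) < e}" for N
  have "\<exists>N. unbounded_height ergodic_trees (super_ergodic_ops scal \<times> {0<..} \<inter> C N) []"
  proof (rule unbounded_height_cover[OF prefix_closed_ergodic_tree unbounded_height_of_space_ergodic_index[OF assms]])
    fix b :: "('a \<Rightarrow>\<^sub>L 'a) \<times> real"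
    assume "b \<in> super_ergodic_ops scal \<times> {0<..}"
    then have "fst b \<in> uniformly_ergodic_ops scal" "snd b > 0" using sub by auto
    then have "Cauchy (cesaro (fst b))" "snd b > 0"
      unfolding uniformly_ergodic_ops_def by (blast intro: LIMSEQ_imp_Cauchy)+
    then have "\<exists>N. \<forall>m\<ge>N. \<forall>n\<ge>N. norm (cesaro (fst b) m - cesaro (fst b) n) < snd b"
      by (rule CauchyD)
    then show "\<exists>N. b \<in> C N" by (simp add: C_def case_prod_unfold)
  qed
  then obtain N where N: "unbounded_height ergodic_trees (super_ergodic_ops scal \<times> {0<..} \<inter> C N) []" ..
  have "\<exists>s. length s = k \<and> unbounded_height ergodic_trees (super_ergodic_ops scal \<times> {0<..} \<inter> C N) s" for k
  proof (induction k)
    case 0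
    then show ?case using N by simp
  next
    case (Suc k)
    then obtain s where "length s = k" "unbounded_height ergodic_trees (super_ergodic_ops scal \<times> {0<..} \<inter> C N) s"
      by blast
    moreover from this obtain a where
      "unbounded_height ergodic_trees (super_ergodic_ops scal \<times> {0<..} \<inter> C N) (s @ [a])"
      using unbounded_height_extend[OF prefix_closed_ergodic_tree] by blast
    ultimately show ?case by (intro exI[of _ "s @ [a]"]) simp
  qed
  \<comment> \<open>Positions start at 0, so \<open>N\<close> and \<open>Suc N\<close> are the last
    two of them, and their entries are at least \<open>N\<close>.\<close>
  then obtain s where s: "length s = N + 2"
    "unbounded_height ergodic_trees (super_ergodic_ops scal \<times> {0<..} \<inter> C N) s" by blast
  obtain T e where Te: "(T, e) \<in> C N" "s \<in> ergodic_tree T e"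
    using unbounded_height_mem[OF s(2)] by auto
  then obtain x where x: "norm x \<le> 1"
      "norm (blinfun_apply (cesaro T (s ! N)) x - blinfun_apply (cesaro T (s ! Suc N)) x) > e"
    using s(1) by (auto simp: ergodic_tree_def)
  have "sorted_wrt (<) s" using Te(2) by (simp add: ergodic_tree_def)
  then have "N \<le> s ! N" "N \<le> s ! Suc N"
    using strict_sorted_nth_ge[of s N] strict_sorted_nth_ge[of s "Suc N"] s(1) by simp_all
  then have "norm (cesaro T (s ! N) - cesaro T (s ! Suc N)) < e"
    using Te(1) by (simp add: C_def)
  moreover have "norm (blinfun_apply (cesaro T (s ! N)) x - blinfun_apply (cesaro T (s ! Suc N)) x)
      \<le> norm (cesaro T (s ! N) - cesaro T (s ! Suc N)) * norm x"
    using norm_blinfun[of "cesaro T (s ! N) - cesaro T (s ! Suc N)" x] by (simp add: blinfun.diff_left)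
  ultimately show False
    using x mult_left_mono[OF x(1) norm_ge_zero[of "cesaro T (s ! N) - cesaro T (s ! Suc N)"]] by simp
qed

section \<open>Ergodic operators that are not super-ergodic\<close>

lemma separable_dense_sequence:
  assumes "separable_space (euclidean :: 'a::topological_space topology)"
  obtains d :: "nat \<Rightarrow> 'a::topological_space" where "closure (range d) = UNIV"
proof -
  obtain C :: "'a set" where C: "countable C" "closure C = UNIV"
    using assms unfolding separable_space_def by auto
  then have "C \<noteq> {}" by auto
  with C have "closure (range (from_nat_into C)) = UNIV" by (simp add: range_from_nat_into)
  then show ?thesis by (rule that)
qed

text \<open>A witness satisfies finitely many strict inequalities, so the witnesses form an open
  set, which meets \<open>D\<close>. The open ball of radius 2 replaces the closed unit ball to make
  the norm condition open as well.\<close>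

lemma ergodic_tree_dense_witness:
  assumes dense: "closure D = UNIV" and s: "s \<in> ergodic_tree T e"
  shows "\<exists>y\<in>D. norm y \<le> 2 \<and> (\<forall>p. Suc p < length s \<longrightarrow>
    e < norm (blinfun_apply (cesaro T (s ! p)) y - blinfun_apply (cesaro T (s ! Suc p)) y))"
proof -
  define V where "V = ball 0 2 \<inter> (\<Inter>p\<in>{p. Suc p < length s}.
    {y. e < norm (blinfun_apply (cesaro T (s ! p)) y - blinfun_apply (cesaro T (s ! Suc p)) y)})"
  have "finite {p. Suc p < length s}"
    by (rule finite_subset[of _ "{..<length s}"]) auto
  then have "open V"
    unfolding V_def by (intro open_Int open_ball open_INT ballI open_Collect_less continuous_intros)
  moreover have "V \<noteq> {}"
  proof (cases "length s \<le> 1")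
    case True
    then have "0 \<in> V" by (simp add: V_def)
    then show ?thesis by blast
  next
    case False
    with s obtain x where "x \<in> cball 0 1" "\<And>p. Suc p < length s \<Longrightarrow>
        e < norm (blinfun_apply (cesaro T (s ! p)) x - blinfun_apply (cesaro T (s ! Suc p)) x)"
      unfolding ergodic_tree_def by blast
    then have "x \<in> V" by (simp add: V_def)
    then show ?thesis by blast
  qed
  ultimately have "D \<inter> V \<noteq> {}"
    using dense open_Int_closure_eq_empty[of V D] by blast
  then obtain y where "y \<in> D" "y \<in> V" by blast
  then show ?thesis by (intro bexI[of _ y]) (auto simp: V_def)
qed

text \<open>The bound \<open>K\<close> and, at each point of \<open>D\<close>, the rate
  \<open>N\<close> do not depend on \<open>k\<close>, so they pass to the strong limit; density and
  the bound then extend the Cauchy condition to the whole space. A rate is required only for large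
  \<open>k\<close>, since each stage of the construction fixes just one more rate.\<close>

lemma ergodic_limit:
  fixes T :: "nat \<Rightarrow> 'a::banach \<Rightarrow>\<^sub>L 'a"
  assumes scal: "normed_scalars scal" and T: "\<And>k. T k \<in> bounded_ops scal"
    and K: "\<And>k. norm (T k) \<le> K" "\<And>k n. norm (cesaro (T k) n) \<le> K"
    and dense: "closure D = UNIV"
    and Cauchy: "\<And>d. d \<in> D \<Longrightarrow> Cauchy (\<lambda>k. blinfun_apply (T k) d)"
    and modulus: "\<And>d e. d \<in> D \<Longrightarrow> e > 0 \<Longrightarrow> \<exists>N. \<forall>m\<ge>N. \<forall>n\<ge>N. \<forall>\<^sub>F k in sequentially.
      norm (blinfun_apply (cesaro (T k) m) d - blinfun_apply (cesaro (T k) n) d) < e"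
  shows "\<exists>S\<in>ergodic_ops scal. \<forall>n x.
    (\<lambda>k. blinfun_apply (cesaro (T k) n) x) \<longlonglongrightarrow> blinfun_apply (cesaro S n) x"
proof -
  obtain S where S: "\<And>x. (\<lambda>k. blinfun_apply (T k) x) \<longlonglongrightarrow> blinfun_apply S x"
    using bounded_Cauchy_blinfun_limit[OF K(1) bounded_Cauchy_dense[OF K(1) dense Cauchy]] by blast
  have lim: "(\<lambda>k. blinfun_apply (cesaro (T k) n) x) \<longlonglongrightarrow> blinfun_apply (cesaro S n) x" for n x
    by (rule cesaro_tendsto[OF K(1) S])
  have "norm (cesaro S n) \<le> K" for n
  proof (rule norm_blinfun_bound)
    show "0 \<le> K" by (rule order_trans[OF norm_ge_zero K(1)])
    fix x
    have "norm (blinfun_apply (cesaro (T k) n) x) \<le> K * norm x" for k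
      by (rule order_trans[OF norm_blinfun mult_right_mono[OF K(2) norm_ge_zero]])
    then show "norm (blinfun_apply (cesaro S n) x) \<le> K * norm x"
      by (intro LIMSEQ_le_const2[OF tendsto_norm[OF lim]]) blast
  qed
  moreover have "Cauchy (\<lambda>n. blinfun_apply (cesaro S n) d)" if d: "d \<in> D" for d
  proof (rule CauchyI)
    fix e :: real assume "e > 0"
    then obtain N where N: "\<And>m n. m \<ge> N \<Longrightarrow> n \<ge> N \<Longrightarrow> \<forall>\<^sub>F k in sequentially.
      norm (blinfun_apply (cesaro (T k) m) d - blinfun_apply (cesaro (T k) n) d) < e / 2"
      using modulus[OF d, of "e / 2"] by auto
    \<comment> \<open>Limits preserve only the weak inequality, hence the margin
      \<open>e / 2\<close>.\<close>
    have "norm (blinfun_apply (cesaro S m) d - blinfun_apply (cesaro S n) d) \<le> e / 2"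
      if "m \<ge> N" "n \<ge> N" for m n
    proof (rule tendsto_upperbound[OF tendsto_norm[OF tendsto_diff[OF lim lim]]])
      show "\<forall>\<^sub>F k in sequentially. norm (blinfun_apply (cesaro (T k) m) d - blinfun_apply (cesaro (T k) n) d) \<le> e / 2"
        using N[OF that] by (rule eventually_mono) simp
    qed simp
    then show "\<exists>N. \<forall>m\<ge>N. \<forall>n\<ge>N. norm (blinfun_apply (cesaro S m) d - blinfun_apply (cesaro S n) d) < e"
      using \<open>e > 0\<close> by (intro exI[of _ N]) (smt (verit) field_sum_of_halves)
  qed
  ultimately have "Cauchy (\<lambda>n. blinfun_apply (cesaro S n) x)" for x
    by (rule bounded_Cauchy_dense[OF _ dense])
  moreover have "S \<in> bounded_ops scal"
    by (rule tendsto_in_bounded_ops[OF scal sequentially_bot T S])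
  ultimately have "S \<in> ergodic_ops scal" by (simp add: ergodic_ops_iff[OF scal])
  with lim show ?thesis by blast
qed

text \<open>One stage of the construction: the node is extended, then the family is cut by three
  countable covers, for the value at \<open>z\<close>, the rate of the Cesaro means at
  \<open>z\<close> and a witness for the new node. Each cut keeps the height unbounded at that
  node.\<close>

lemma ergodic_trees_step:
  fixes d :: "nat \<Rightarrow> 'a::banach" and M :: "(('a \<Rightarrow>\<^sub>L 'a) \<times> real) set"
  assumes scal: "normed_scalars scal" and dense: "closure (range d) = UNIV" and "r > 0"
    and M: "M \<subseteq> ergodic_ops scal \<times> UNIV" and large: "unbounded_height ergodic_trees M s"
  shows "\<exists>M' a. M' \<subseteq> M \<and> unbounded_height ergodic_trees M' (s @ [a]) \<and>
    (\<exists>c. \<forall>b\<in>M'. norm (blinfun_apply (fst b) z - c) < r) \<and>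
    (\<exists>N. \<forall>b\<in>M'. \<forall>m\<ge>N. \<forall>n\<ge>N. norm (blinfun_apply (cesaro (fst b) m) z - blinfun_apply (cesaro (fst b) n) z) < r) \<and>
    (\<exists>y. norm y \<le> 2 \<and> (\<forall>b\<in>M'. \<forall>p. Suc p < length (s @ [a]) \<longrightarrow>
      snd b < norm (blinfun_apply (cesaro (fst b) ((s @ [a]) ! p)) y - blinfun_apply (cesaro (fst b) ((s @ [a]) ! Suc p)) y)))"
proof -
  note pc = prefix_closed_ergodic_tree
  obtain a where "unbounded_height ergodic_trees M (s @ [a])"
    using unbounded_height_extend[OF pc large] by blast
  moreover define s' where "s' = s @ [a]"
  ultimately have 0: "unbounded_height ergodic_trees M s'" by simp
  define C1 :: "nat \<Rightarrow> (('a \<Rightarrow>\<^sub>L 'a) \<times> real) set"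
    where "C1 c = {b. norm (blinfun_apply (fst b) z - d c) < r}" for c
  define C2 :: "nat \<Rightarrow> (('a \<Rightarrow>\<^sub>L 'a) \<times> real) set"
    where "C2 N = {b. \<forall>m\<ge>N. \<forall>n\<ge>N.
    norm (blinfun_apply (cesaro (fst b) m) z - blinfun_apply (cesaro (fst b) n) z) < r}" for N
  define C3 :: "nat \<Rightarrow> (('a \<Rightarrow>\<^sub>L 'a) \<times> real) set"
    where "C3 i = {b. norm (d i) \<le> 2 \<and> (\<forall>p. Suc p < length s' \<longrightarrow>
    snd b < norm (blinfun_apply (cesaro (fst b) (s' ! p)) (d i) - blinfun_apply (cesaro (fst b) (s' ! Suc p)) (d i)))}" for i
  have "\<exists>c. unbounded_height ergodic_trees (M \<inter> C1 c) s'"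
  proof (rule unbounded_height_cover[OF pc 0])
    fix b :: "('a \<Rightarrow>\<^sub>L 'a) \<times> real"
    have "blinfun_apply (fst b) z \<in> closure (range d)" using dense by simp
    then obtain y where "y \<in> range d" "dist y (blinfun_apply (fst b) z) < r"
      using \<open>r > 0\<close> unfolding closure_approachable by blast
    then show "\<exists>c. b \<in> C1 c" by (auto simp: C1_def dist_norm norm_minus_commute)
  qed
  then obtain c where 1: "unbounded_height ergodic_trees (M \<inter> C1 c) s'" ..
  have "\<exists>N. unbounded_height ergodic_trees (M \<inter> C1 c \<inter> C2 N) s'"
  proof (rule unbounded_height_cover[OF pc 1])
    fix b assume "b \<in> M \<inter> C1 c"
    then have "Cauchy (\<lambda>n. blinfun_apply (cesaro (fst b) n) z)"
      using M by (auto simp: ergodic_ops_iff[OF scal])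
    from CauchyD[OF this \<open>r > 0\<close>] show "\<exists>N. b \<in> C2 N" by (simp add: C2_def)
  qed
  then obtain N where 2: "unbounded_height ergodic_trees (M \<inter> C1 c \<inter> C2 N) s'" ..
  \<comment> \<open>This cover is available only for pairs whose tree contains \<open>s'\<close>:
    then the dense sequence contains a witness.\<close>
  have "\<exists>i. unbounded_height ergodic_trees (M \<inter> C1 c \<inter> C2 N \<inter> C3 i) s'"
  proof (rule unbounded_height_cover[OF pc 2])
    fix b :: "('a \<Rightarrow>\<^sub>L 'a) \<times> real"
    assume "s' \<in> ergodic_trees b"
    from ergodic_tree_dense_witness[OF dense this] show "\<exists>i. b \<in> C3 i" by (auto simp: C3_def)
  qed
  then obtain i where 3: "unbounded_height ergodic_trees (M \<inter> C1 c \<inter> C2 N \<inter> C3 i) s'" ..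
  let ?M' = "M \<inter> C1 c \<inter> C2 N \<inter> C3 i"
  have "\<forall>b\<in>?M'. norm (blinfun_apply (fst b) z - d c) < r"
    by (auto simp: C1_def)
  moreover have "\<forall>b\<in>?M'. \<forall>m\<ge>N. \<forall>n\<ge>N.
      norm (blinfun_apply (cesaro (fst b) m) z - blinfun_apply (cesaro (fst b) n) z) < r"
    by (auto simp: C2_def)
  \<comment> \<open>The bound on \<open>d i\<close> is part of \<open>C3 i\<close>, so any member of
    the piece yields it.\<close>
  moreover have "norm (d i) \<le> 2"
    using unbounded_height_nonempty[OF 3] by (auto simp: C3_def)
  moreover have "\<forall>b\<in>?M'. \<forall>p. Suc p < length s' \<longrightarrow>
      snd b < norm (blinfun_apply (cesaro (fst b) (s' ! p)) (d i) - blinfun_apply (cesaro (fst b) (s' ! Suc p)) (d i))"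
    by (auto simp: C3_def)
  ultimately show ?thesis
    using 3 unfolding s'_def by (intro exI[of _ ?M'] exI[of _ a]) blast
qed

lemma exists_ergodic_not_super_ergodic:
  fixes scal :: "'k::real_normed_field \<Rightarrow> 'a::banach \<Rightarrow> 'a"
  assumes scal: "normed_scalars scal" and sep: "separable_space (euclidean :: 'a topology)"
    and index: "space_ergodic_index scal = omega1"
  shows "\<not> ergodic_ops scal \<subseteq> super_ergodic_ops scal"
proof
  assume sub: "ergodic_ops scal \<subseteq> super_ergodic_ops scal"
  obtain d :: "nat \<Rightarrow> 'a" where dense: "closure (range d) = UNIV"
    using separable_dense_sequence[OF sep] .
  \<comment> \<open>The first cut bounds all operators and their Cesaro means by one
    \<open>K\<close> and keeps every \<epsilon> above \<open>1 / real (Suc q)\<close>, so that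
    neither the bounds nor the oscillation is lost in the limit.\<close>
  define C :: "nat \<times> nat \<Rightarrow> (('a \<Rightarrow>\<^sub>L 'a) \<times> real) set" where
    "C = (\<lambda>(K, q). {b. norm (fst b) \<le> real K \<and> (\<forall>n. norm (cesaro (fst b) n) \<le> real K) \<and>
      1 / real (Suc q) < snd b})"
  have "\<exists>c. unbounded_height ergodic_trees (super_ergodic_ops scal \<times> {0<..} \<inter> C c) []"
  proof (rule unbounded_height_cover[OF prefix_closed_ergodic_tree unbounded_height_of_space_ergodic_index[OF index]])
    fix b :: "('a \<Rightarrow>\<^sub>L 'a) \<times> real"
    assume "b \<in> super_ergodic_ops scal \<times> {0<..}"
    then have b: "fst b \<in> super_ergodic_ops scal" "snd b > 0" by auto
    obtain L where L: "\<And>n. norm (cesaro (fst b) n) \<le> L"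
      using ergodic_ops_bounded_cesaro[OF scal super_ergodic_imp_ergodic[OF scal b(1)]] by blast
    obtain K :: nat where "max L (norm (fst b)) \<le> real K" using real_arch_simple by blast
    then have "norm (fst b) \<le> real K" "L \<le> real K" by simp_all
    moreover from this have "norm (cesaro (fst b) n) \<le> real K" for n using L[of n] by simp
    moreover obtain q where "1 / real (Suc q) < snd b" using nat_approx_posE[OF b(2)] .
    ultimately have "b \<in> C (K, q)" by (simp add: C_def)
    then show "\<exists>c. b \<in> C c" by blast
  qed
  then obtain K q where large0: "unbounded_height ergodic_trees (super_ergodic_ops scal \<times> {0<..} \<inter> C (K, q)) []"
    by auto
  define M0 where "M0 = super_ergodic_ops scal \<times> {0<..} \<inter> C (K, q)"
  have M0: "M0 \<subseteq> ergodic_ops scal \<times> UNIV"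
    using super_ergodic_imp_ergodic[OF scal] by (auto simp: M0_def)
  \<comment> \<open>Stage \<open>k\<close> codes a pair \<open>(i, j)\<close> and treats the point
    \<open>d i\<close> with tolerance \<open>1 / real (Suc j)\<close>; thus every point is treated
    at every tolerance.\<close>
  define point where "point k = d (fst (prod_decode k))" for k
  define r :: "nat \<Rightarrow> real" where "r k = 1 / real (Suc (snd (prod_decode k)))" for k
  define good where "good k M \<longleftrightarrow>
    (\<exists>c. \<forall>b\<in>M. norm (blinfun_apply (fst b) (point k) - c) < r k) \<and>
    (\<exists>N. \<forall>b\<in>M. \<forall>m\<ge>N. \<forall>n\<ge>N.
      norm (blinfun_apply (cesaro (fst b) m) (point k) - blinfun_apply (cesaro (fst b) n) (point k)) < r k)"
    for k and M :: "(('a \<Rightarrow>\<^sub>L 'a) \<times> real) set"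
  define wit where "wit s M \<longleftrightarrow> (\<exists>y. norm y \<le> 2 \<and> (\<forall>b\<in>M. \<forall>p. Suc p < length s \<longrightarrow>
      snd b < norm (blinfun_apply (cesaro (fst b) (s ! p)) y - blinfun_apply (cesaro (fst b) (s ! Suc p)) y)))"
    for s and M :: "(('a \<Rightarrow>\<^sub>L 'a) \<times> real) set"
  have step: "\<exists>M' a. M' \<subseteq> M \<and> unbounded_height ergodic_trees M' (s @ [a]) \<and> good k M' \<and> wit (s @ [a]) M'"
    if "M \<subseteq> M0" "unbounded_height ergodic_trees M s" for k M s
  proof -
    have "0 < r k" by (simp add: r_def)
    from ergodic_trees_step[OF scal dense this order_trans[OF that(1) M0] that(2), of "point k"]
    show ?thesis unfolding good_def wit_def by blast
  qed
  \<comment> \<open>Dependent choice with a piece and a node as state; the clause for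
    \<open>k = 0\<close> pins the first node to the root.\<close>
  have "\<exists>f. \<forall>k. (fst (f k) \<subseteq> M0 \<and> unbounded_height ergodic_trees (fst (f k)) (snd (f k)) \<and> (k = 0 \<longrightarrow> snd (f k) = [])) \<and>
    (fst (f (Suc k)) \<subseteq> fst (f k) \<and> (\<exists>a. snd (f (Suc k)) = snd (f k) @ [a]) \<and>
      good k (fst (f (Suc k))) \<and> wit (snd (f (Suc k))) (fst (f (Suc k))))"
  proof (rule dependent_nat_choice)
    show "\<exists>x. fst x \<subseteq> M0 \<and> unbounded_height ergodic_trees (fst x) (snd x) \<and> ((0::nat) = 0 \<longrightarrow> snd x = [])"
      using large0 by (intro exI[of _ "(M0, [])"]) (simp add: M0_def)
  next
    fix x and k :: nat
    assume "fst x \<subseteq> M0 \<and> unbounded_height ergodic_trees (fst x) (snd x) \<and> (k = 0 \<longrightarrow> snd x = [])"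
    then have x: "fst x \<subseteq> M0" "unbounded_height ergodic_trees (fst x) (snd x)" by auto
    from step[OF x, of k] obtain M' a where "M' \<subseteq> fst x" "unbounded_height ergodic_trees M' (snd x @ [a])"
      "good k M'" "wit (snd x @ [a]) M'" by blast
    with x(1) show "\<exists>y. (fst y \<subseteq> M0 \<and> unbounded_height ergodic_trees (fst y) (snd y) \<and> (Suc k = 0 \<longrightarrow> snd y = [])) \<and>
      (fst y \<subseteq> fst x \<and> (\<exists>a. snd y = snd x @ [a]) \<and> good k (fst y) \<and> wit (snd y) (fst y))"
      by (intro exI[of _ "(M', snd x @ [a])"]) auto
  qed
  then obtain f where f: "\<And>k. fst (f k) \<subseteq> M0" "\<And>k. unbounded_height ergodic_trees (fst (f k)) (snd (f k))"
      "snd (f 0) = []" "\<And>k. fst (f (Suc k)) \<subseteq> fst (f k)" "\<And>k. \<exists>a. snd (f (Suc k)) = snd (f k) @ [a]"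
      "\<And>k. good k (fst (f (Suc k)))" "\<And>k. wit (snd (f (Suc k))) (fst (f (Suc k)))"
    by blast
  obtain a where a: "\<And>k. snd (f (Suc k)) = snd (f k) @ [a k]" using f(5) by metis
  have s: "snd (f k) = map a [0..<k]" for k
    by (induction k) (simp_all add: f(3) a)
  have "\<exists>b. b \<in> fst (f k) \<and> snd (f k) \<in> ergodic_trees b" for k
    using unbounded_height_mem[OF f(2)] by blast
  then obtain b where b: "\<And>k. b k \<in> fst (f k)" "\<And>k. snd (f k) \<in> ergodic_trees (b k)" by metis
  define T where "T k = fst (b k)" for k
  \<comment> \<open>The pieces decrease, so whatever holds throughout the piece of stage
    \<open>k\<close> holds for all later choices \<open>b j\<close>.\<close>
  have mono: "b j \<in> fst (f k)" if "k \<le> j" for j k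
    using b(1)[of j] lift_Suc_antimono_le[of "\<lambda>k. fst (f k)", OF f(4) that] by blast
  have bM0: "b k \<in> M0" for k using b(1) f(1) by blast
  have "\<exists>S\<in>ergodic_ops scal. \<forall>n x.
    (\<lambda>k. blinfun_apply (cesaro (T k) n) x) \<longlonglongrightarrow> blinfun_apply (cesaro S n) x"
  proof (rule ergodic_limit[OF scal _ _ _ dense])
    fix k
    show "T k \<in> bounded_ops scal" "norm (T k) \<le> real K" "norm (cesaro (T k) n) \<le> real K" for n
      using bM0[of k] by (auto simp: T_def M0_def C_def super_ergodic_ops_def)
  next
    fix z assume "z \<in> range d"
    then obtain i where i: "z = d i" by blast
    show "Cauchy (\<lambda>k. blinfun_apply (T k) z)"
    proof (rule CauchyI)
      fix e :: real assume "e > 0"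
      then obtain j where j: "1 / real (Suc j) < e / 2" using nat_approx_posE[of "e / 2"] by auto
      \<comment> \<open>The stage that treats \<open>d i\<close> at a tolerance below
        \<open>e / 2\<close>; from then on all values at \<open>z\<close> are this close to one
        vector \<open>c\<close>.\<close>
      define k where "k = prod_encode (i, j)"
      have k: "point k = z" "r k < e / 2" using i j by (simp_all add: k_def point_def r_def)
      obtain c where c: "\<And>b. b \<in> fst (f (Suc k)) \<Longrightarrow> norm (blinfun_apply (fst b) z - c) < r k"
        using f(6)[of k] unfolding good_def k(1) by blast
      have "norm (blinfun_apply (T m) z - blinfun_apply (T n) z) < e" if "m \<ge> Suc k" "n \<ge> Suc k" for m n
        using c[OF mono[OF that(1)]] c[OF mono[OF that(2)]] k(2)
          norm_triangle_ineq4[of "blinfun_apply (T m) z - c" "blinfun_apply (T n) z - c"]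
        by (simp add: T_def)
      then show "\<exists>N. \<forall>m\<ge>N. \<forall>n\<ge>N. norm (blinfun_apply (T m) z - blinfun_apply (T n) z) < e" by blast
    qed
    fix e :: real assume "e > 0"
    then obtain j where j: "1 / real (Suc j) < e" using nat_approx_posE by blast
    define k where "k = prod_encode (i, j)"
    have k: "point k = z" "r k < e" using i j by (simp_all add: k_def point_def r_def)
    obtain N where N: "\<And>b m n. b \<in> fst (f (Suc k)) \<Longrightarrow> m \<ge> N \<Longrightarrow> n \<ge> N \<Longrightarrow>
        norm (blinfun_apply (cesaro (fst b) m) z - blinfun_apply (cesaro (fst b) n) z) < r k"
      using f(6)[of k] unfolding good_def k(1) by blast
    have "\<forall>\<^sub>F l in sequentially. norm (blinfun_apply (cesaro (T l) m) z - blinfun_apply (cesaro (T l) n) z) < e"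
      if "m \<ge> N" "n \<ge> N" for m n
      using eventually_ge_at_top[of "Suc k"]
    proof eventually_elim
      case (elim l)
      from N[OF mono[OF elim] that] k(2) show ?case by (simp add: T_def)
    qed
    then show "\<exists>N. \<forall>m\<ge>N. \<forall>n\<ge>N. \<forall>\<^sub>F l in sequentially.
        norm (blinfun_apply (cesaro (T l) m) z - blinfun_apply (cesaro (T l) n) z) < e" by blast
  qed
  then obtain S where S: "S \<in> ergodic_ops scal"
    and lim: "\<And>n x. (\<lambda>k. blinfun_apply (cesaro (T k) n) x) \<longlonglongrightarrow> blinfun_apply (cesaro S n) x"
    by blast
  define \<delta> where "\<delta> = 1 / real (Suc q)"
  have "\<delta> > 0" by (simp add: \<delta>_def)
  \<comment> \<open>The recorded \<open>y\<close> has norm at most 2 and oscillates by more than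
    \<delta> for all late \<open>T j\<close>; the limit keeps at least \<delta>. Halving
    \<open>y\<close> to reach the unit ball leaves \<delta> / 2, and \<delta> / 4 restores the
    strict inequality.\<close>
  have "map a [0..<k] \<in> ergodic_tree S (\<delta> / 4)" for k
  proof (cases k)
    case 0
    then show ?thesis by (simp add: ergodic_tree_def)
  next
    case (Suc l)
    let ?s = "map a [0..<k]"
    obtain y where y: "norm y \<le> 2" and osc: "\<And>b p. b \<in> fst (f k) \<Longrightarrow> Suc p < length ?s \<Longrightarrow>
        snd b < norm (blinfun_apply (cesaro (fst b) (?s ! p)) y - blinfun_apply (cesaro (fst b) (?s ! Suc p)) y)"
      using f(7)[of l] unfolding wit_def s Suc by blast
    have "\<delta> / 4 < norm (blinfun_apply (cesaro S (?s ! p)) ((1/2) *\<^sub>R y) - blinfun_apply (cesaro S (?s ! Suc p)) ((1/2) *\<^sub>R y))"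
      if p: "Suc p < length ?s" for p
    proof -
      have "\<delta> \<le> norm (blinfun_apply (cesaro S (?s ! p)) y - blinfun_apply (cesaro S (?s ! Suc p)) y)"
      proof (rule tendsto_lowerbound[OF tendsto_norm[OF tendsto_diff[OF lim lim]]])
        show "\<forall>\<^sub>F j in sequentially.
          \<delta> \<le> norm (blinfun_apply (cesaro (T j) (?s ! p)) y - blinfun_apply (cesaro (T j) (?s ! Suc p)) y)"
          using eventually_ge_at_top[of k]
        proof eventually_elim
          case (elim j)
          have "\<delta> < snd (b j)" using bM0[of j] by (simp add: M0_def C_def \<delta>_def)
          with osc[OF mono[OF elim] p] show ?case by (simp add: T_def)
        qed
      qed simp
      then show ?thesis
        using \<open>\<delta> > 0\<close> by (simp add: blinfun.scaleR_right flip: scaleR_diff_right)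
    qed
    moreover have "(1/2) *\<^sub>R y \<in> cball 0 1" using y by simp
    \<comment> \<open>That the entries increase and avoid 0 does not depend on the operator, so it
      is read off from the tree of \<open>b k\<close>.\<close>
    moreover have "sorted_wrt (<) ?s" "0 \<notin> set ?s"
      using b(2)[of k] unfolding ergodic_tree_def s by blast+
    ultimately show ?thesis unfolding ergodic_tree_def by blast
  qed
  \<comment> \<open>The assumption being refuted makes the limit \<open>S\<close> super-ergodic, so
    its tree can have no infinite branch.\<close>
  moreover have "S \<in> super_ergodic_ops scal" using S sub by blast
  moreover have "\<delta> / 4 > 0" using \<open>\<delta> > 0\<close> by simp
  ultimately show False using super_ergodic_no_branch by blast
qed

theorem mainTheorem4:
  fixes scal :: "'k::real_normed_field \<Rightarrow> 'a::banach \<Rightarrow> 'a"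
  assumes "normed_scalars scal"
    and "separable_space (euclidean :: 'a topology)"
    and "\<nexists>B. finite B \<and> module.span scal B = UNIV"
    and "space_ergodic_index scal = omega1"
  shows "uniformly_ergodic_ops scal \<subset> super_ergodic_ops scal \<and>
    super_ergodic_ops scal \<subset> ergodic_ops scal"
proof (intro conjI psubsetI subsetI notI)
  show "T \<in> super_ergodic_ops scal" if "T \<in> uniformly_ergodic_ops scal" for T
    by (rule uniformly_ergodic_imp_super_ergodic[OF assms(1) that])
  show "T \<in> ergodic_ops scal" if "T \<in> super_ergodic_ops scal" for T
    by (rule super_ergodic_imp_ergodic[OF assms(1) that])
  show False if "uniformly_ergodic_ops scal = super_ergodic_ops scal"
    using exists_super_ergodic_not_uniformly_ergodic[OF assms(4)] that by simp
  show False if "super_ergodic_ops scal = ergodic_ops scal"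
    using exists_ergodic_not_super_ergodic[OF assms(1,2,4)] that by simp
qed

end
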